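(* Let $G\colon\mathscr{X}\to\mathscr{A}$ be a right adjoint functor between (large) categories whose monadic tower exists for any finite step and such that all the Eilenberg--Moore categories appearing in the tower have reflexive coequalizers. Let $n$ be a natural number. If $G$ can be decomposed into a coreflection followed by a composite of $n$ strictly monadic functors, i.e. $G=U_1\circ\cdots\circ U_n\circ R$ with $R$ a coreflection and $U_1,\dots,U_n$ strictly monadic, then the monadic tower of $G$ stabilizes at (or before) $n$.
   Context: A functor is a coreflection if it has a fully faithful left adjoint. A functor $U\colon\mathscr{B}\to\mathscr{A}$ is strictly monadic if it has a left adjoint and the comparison functor from $\mathscr{B}$ to the Eilenberg--Moore category of the induced monad on $\mathscr{A}$ is an isomorphism of categories. Monadic tower (finite steps) of a right adjoint $G\colon\mathscr{X}\to\mathscr{A}$: put $\mathscr{A}_0=\mathscr{A}$, $G_0=G$. Given a right adjoint $G_k\colon\mathscr{X}\to\mathscr{A}_k$, let $\mathscr{A}_{k+1}$ be the Eilenberg--Moore category of the monad on $\mathscr{A}_k$ induced by $G_k$ and its left adjoint, with forgetful functor $\mathscr{A}_{k+1}\to\mathscr{A}_k$, and let $G_{k+1}\colon\mathscr{X}\to\mathscr{A}_{k+1}$ be the comparison functor. The tower exists for any finite step if every $G_k$ ($k<\omega$) obtained in this way is again a right adjoint. The Eilenberg--Moore categories appearing in the tower are the $\mathscr{A}_k$ with $0<k<\omega$. The tower stabilizes at $k$ if the forgetful functors $\mathscr{A}_{j+1}\to\mathscr{A}_j$ are isomorphisms of categories for all finite $j\ge k$. *)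

theory Defs
  imports Main
begin

section \<open>Categories and functors\<close>

text \<open>
  A category is given by a set of objects and a family of hom-sets. No size restriction is imposed,
  and hom-sets of different pairs of objects need not be disjoint: the same element of
  \<open>'m\<close> may be a morphism between several pairs of objects. This lets a morphism of
  algebras be represented by its underlying morphism. Accordingly, the morphism part of a functor
  also takes the source and the target object as arguments. Only values on objects and on
  morphisms between objects are meaningful.
\<close>

record ('o, 'm) cat =
  Obj :: "'o set"
  Hom :: "'o \<Rightarrow> 'o \<Rightarrow> 'm set"
  Ident :: "'o \<Rightarrow> 'm"
  Comp :: "'m \<Rightarrow> 'm \<Rightarrow> 'm"  \<comment> \<open>\<open>Comp C g f\<close> is \<open>g\<close> after \<open>f\<close>\<close>

locale category =
  fixes C :: "('o, 'm) cat"
  assumes id_in_hom: "a \<in> Obj C \<Longrightarrow> Ident C a \<in> Hom C a a"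
    and comp_in_hom: "\<lbrakk>a \<in> Obj C; b \<in> Obj C; c \<in> Obj C; f \<in> Hom C a b; g \<in> Hom C b c\<rbrakk>
      \<Longrightarrow> Comp C g f \<in> Hom C a c"
    and comp_id_right: "\<lbrakk>a \<in> Obj C; b \<in> Obj C; f \<in> Hom C a b\<rbrakk> \<Longrightarrow> Comp C f (Ident C a) = f"
    and comp_id_left: "\<lbrakk>a \<in> Obj C; b \<in> Obj C; f \<in> Hom C a b\<rbrakk> \<Longrightarrow> Comp C (Ident C b) f = f"
    and comp_assoc: "\<lbrakk>a \<in> Obj C; b \<in> Obj C; c \<in> Obj C; d \<in> Obj C;
        f \<in> Hom C a b; g \<in> Hom C b c; h \<in> Hom C c d\<rbrakk>
      \<Longrightarrow> Comp C (Comp C h g) f = Comp C h (Comp C g f)"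

record ('o, 'm, 'p, 'q) func =
  FObj :: "'o \<Rightarrow> 'p"
  FHom :: "'o \<Rightarrow> 'o \<Rightarrow> 'm \<Rightarrow> 'q"

locale cat_functor = source: category C + target: category D
  for C :: "('o, 'm) cat" and D :: "('p, 'q) cat" +
  fixes F :: "('o, 'm, 'p, 'q) func"
  assumes fobj_in_obj: "a \<in> Obj C \<Longrightarrow> FObj F a \<in> Obj D"
    and fhom_in_hom: "\<lbrakk>a \<in> Obj C; b \<in> Obj C; f \<in> Hom C a b\<rbrakk>
      \<Longrightarrow> FHom F a b f \<in> Hom D (FObj F a) (FObj F b)"
    and fhom_id: "a \<in> Obj C \<Longrightarrow> FHom F a a (Ident C a) = Ident D (FObj F a)"
    and fhom_comp: "\<lbrakk>a \<in> Obj C; b \<in> Obj C; c \<in> Obj C; f \<in> Hom C a b; g \<in> Hom C b c\<rbrakk>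
      \<Longrightarrow> FHom F a c (Comp C g f) = Comp D (FHom F b c g) (FHom F a b f)"

definition id_func :: "('o, 'm, 'o, 'm) func" where
  "id_func = \<lparr>FObj = (\<lambda>a. a), FHom = (\<lambda>a b f. f)\<rparr>"

definition comp_func ::
    "('p, 'q, 'r, 's) func \<Rightarrow> ('o, 'm, 'p, 'q) func \<Rightarrow> ('o, 'm, 'r, 's) func" (infixl "\<circ>\<^sub>F" 55) where
  "K \<circ>\<^sub>F H = \<lparr>FObj = (\<lambda>a. FObj K (FObj H a)),
             FHom = (\<lambda>a b f. FHom K (FObj H a) (FObj H b) (FHom H a b f))\<rparr>"

definition func_eq_on ::
    "('o, 'm) cat \<Rightarrow> ('o, 'm, 'p, 'q) func \<Rightarrow> ('o, 'm, 'p, 'q) func \<Rightarrow> bool" where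
  "func_eq_on C F G \<longleftrightarrow>
     (\<forall>a \<in> Obj C. FObj F a = FObj G a) \<and>
     (\<forall>a \<in> Obj C. \<forall>b \<in> Obj C. \<forall>f \<in> Hom C a b. FHom F a b f = FHom G a b f)"

definition cat_isomorphism :: "('o, 'm) cat \<Rightarrow> ('p, 'q) cat \<Rightarrow> ('o, 'm, 'p, 'q) func \<Rightarrow> bool" where
  "cat_isomorphism C D F \<longleftrightarrow> cat_functor C D F \<and>
     (\<exists>F'. cat_functor D C F' \<and> func_eq_on C (F' \<circ>\<^sub>F F) id_func \<and> func_eq_on D (F \<circ>\<^sub>F F') id_func)"

definition fully_faithful :: "('o, 'm) cat \<Rightarrow> ('p, 'q) cat \<Rightarrow> ('o, 'm, 'p, 'q) func \<Rightarrow> bool" where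
  "fully_faithful C D F \<longleftrightarrow>
     (\<forall>a \<in> Obj C. \<forall>b \<in> Obj C. bij_betw (FHom F a b) (Hom C a b) (Hom D (FObj F a) (FObj F b)))"

definition is_coequalizer ::
    "('o, 'm) cat \<Rightarrow> 'o \<Rightarrow> 'o \<Rightarrow> 'm \<Rightarrow> 'm \<Rightarrow> 'o \<Rightarrow> 'm \<Rightarrow> bool" where
  "is_coequalizer C a b f g c q \<longleftrightarrow>
     c \<in> Obj C \<and> q \<in> Hom C b c \<and> Comp C q f = Comp C q g \<and>
     (\<forall>d \<in> Obj C. \<forall>h \<in> Hom C b d. Comp C h f = Comp C h g \<longrightarrow>
        (\<exists>!u. u \<in> Hom C c d \<and> Comp C u q = h))"

definition has_reflexive_coequalizers :: "('o, 'm) cat \<Rightarrow> bool" where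
  "has_reflexive_coequalizers C \<longleftrightarrow>
     (\<forall>a \<in> Obj C. \<forall>b \<in> Obj C. \<forall>f \<in> Hom C a b. \<forall>g \<in> Hom C a b.
        (\<exists>s \<in> Hom C b a. Comp C f s = Ident C b \<and> Comp C g s = Ident C b) \<longrightarrow>
        (\<exists>c q. is_coequalizer C a b f g c q))"


section \<open>Adjunctions\<close>

text \<open>The data exhibiting a left adjoint of a functor from \<open>X\<close> to \<open>A\<close>.\<close>

record ('o, 'm, 'x, 'y) adj_data =
  LAdj :: "('o, 'm, 'x, 'y) func"
  Unit :: "'o \<Rightarrow> 'm"
  Counit :: "'x \<Rightarrow> 'y"

locale adjunction =
  right: cat_functor X A G + left: cat_functor A X "LAdj J"
  for X :: "('x, 'y) cat" and A :: "('o, 'm) cat"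
    and G :: "('x, 'y, 'o, 'm) func" and J :: "('o, 'm, 'x, 'y) adj_data" +
  assumes unit_in_hom: "a \<in> Obj A \<Longrightarrow> Unit J a \<in> Hom A a (FObj (G \<circ>\<^sub>F LAdj J) a)"
    and unit_natural: "\<lbrakk>a \<in> Obj A; b \<in> Obj A; f \<in> Hom A a b\<rbrakk>
      \<Longrightarrow> Comp A (FHom (G \<circ>\<^sub>F LAdj J) a b f) (Unit J a) = Comp A (Unit J b) f"
    and counit_in_hom: "x \<in> Obj X \<Longrightarrow> Counit J x \<in> Hom X (FObj (LAdj J \<circ>\<^sub>F G) x) x"
    and counit_natural: "\<lbrakk>x \<in> Obj X; y \<in> Obj X; g \<in> Hom X x y\<rbrakk>
      \<Longrightarrow> Comp X g (Counit J x) = Comp X (Counit J y) (FHom (LAdj J \<circ>\<^sub>F G) x y g)"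
    and triangle_left: "a \<in> Obj A \<Longrightarrow>
      Comp X (Counit J (FObj (LAdj J) a))
             (FHom (LAdj J) a (FObj (G \<circ>\<^sub>F LAdj J) a) (Unit J a)) = Ident X (FObj (LAdj J) a)"
    and triangle_right: "x \<in> Obj X \<Longrightarrow>
      Comp A (FHom G (FObj (LAdj J \<circ>\<^sub>F G) x) x (Counit J x)) (Unit J (FObj G x)) = Ident A (FObj G x)"

definition right_adjoint :: "('x, 'y) cat \<Rightarrow> ('o, 'm) cat \<Rightarrow> ('x, 'y, 'o, 'm) func \<Rightarrow> bool" where
  "right_adjoint X A G \<longleftrightarrow> (\<exists>J. adjunction X A G J)"

definition coreflection :: "('x, 'y) cat \<Rightarrow> ('o, 'm) cat \<Rightarrow> ('x, 'y, 'o, 'm) func \<Rightarrow> bool" where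
  "coreflection X A R \<longleftrightarrow> (\<exists>J. adjunction X A R J \<and> fully_faithful A X (LAdj J))"


section \<open>Monads, Eilenberg--Moore categories and monadic functors\<close>

record ('o, 'm) monad_data =
  MFunc :: "('o, 'm, 'o, 'm) func"
  MUnit :: "'o \<Rightarrow> 'm"
  MMult :: "'o \<Rightarrow> 'm"

definition induced_monad ::
    "('x, 'y, 'o, 'm) func \<Rightarrow> ('o, 'm, 'x, 'y) adj_data \<Rightarrow> ('o, 'm) monad_data" where
  "induced_monad G J =
     \<lparr>MFunc = G \<circ>\<^sub>F LAdj J,
      MUnit = Unit J,
      MMult = (\<lambda>a. FHom G (FObj (LAdj J \<circ>\<^sub>F G \<circ>\<^sub>F LAdj J) a) (FObj (LAdj J) a)
                          (Counit J (FObj (LAdj J) a)))\<rparr>"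

definition is_algebra :: "('o, 'm) cat \<Rightarrow> ('o, 'm) monad_data \<Rightarrow> 'o \<Rightarrow> 'm \<Rightarrow> bool" where
  "is_algebra C T a h \<longleftrightarrow>
     a \<in> Obj C \<and> h \<in> Hom C (FObj (MFunc T) a) a \<and>
     Comp C h (MUnit T a) = Ident C a \<and>
     Comp C h (MMult T a) = Comp C h (FHom (MFunc T) (FObj (MFunc T) a) a h)"

definition EM :: "('o, 'm) cat \<Rightarrow> ('o, 'm) monad_data \<Rightarrow> ('o \<times> 'm, 'm) cat" where
  "EM C T =
     \<lparr>Obj = {(a, h). is_algebra C T a h},
      Hom = (\<lambda>(a, h) (b, k). {f \<in> Hom C a b. Comp C f h = Comp C k (FHom (MFunc T) a b f)}),
      Ident = (\<lambda>(a, h). Ident C a),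
      Comp = Comp C\<rparr>"

definition EM_forget :: "('o \<times> 'm, 'm, 'o, 'm) func" where
  "EM_forget = \<lparr>FObj = fst, FHom = (\<lambda>p q f. f)\<rparr>"

definition comparison ::
    "('x, 'y, 'o, 'm) func \<Rightarrow> ('o, 'm, 'x, 'y) adj_data \<Rightarrow> ('x, 'y, 'o \<times> 'm, 'm) func" where
  "comparison G J =
     \<lparr>FObj = (\<lambda>x. (FObj G x, FHom G (FObj (LAdj J \<circ>\<^sub>F G) x) x (Counit J x))),
      FHom = FHom G\<rparr>"

definition strictly_monadic :: "('p, 'q) cat \<Rightarrow> ('o, 'm) cat \<Rightarrow> ('p, 'q, 'o, 'm) func \<Rightarrow> bool" where
  "strictly_monadic B A U \<longleftrightarrow>
     (\<exists>J. adjunction B A U J \<and> cat_isomorphism B (EM A (induced_monad U J)) (comparison U J))"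

text \<open>\<open>comp_chain U n\<close> is \<open>U 1 \<circ>\<^sub>F \<dots> \<circ>\<^sub>F U n\<close>.\<close>

primrec comp_chain :: "(nat \<Rightarrow> ('o, 'm, 'o, 'm) func) \<Rightarrow> nat \<Rightarrow> ('o, 'm, 'o, 'm) func" where
  "comp_chain U 0 = id_func"
| "comp_chain U (Suc n) = comp_chain U n \<circ>\<^sub>F U (Suc n)"


section \<open>The monadic tower\<close>

text \<open>
  Iterating \<open>EM\<close> changes the type of objects at every step. To have all the categories of the
  tower at one type, objects are tagged: an object of step \<open>0\<close> is \<open>Base a\<close> with \<open>a\<close> an object of
  the given category, and an object of step \<open>Suc k\<close> is \<open>Alg (p, h)\<close> where \<open>p\<close> is an object of
  step \<open>k\<close> and \<open>(p, h)\<close> an algebra. Morphisms are represented by the underlying morphisms of the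
  given category.
\<close>

datatype ('o, 'm) tower_obj =
  Base (unBase: 'o)
| Alg (unAlg: "('o, 'm) tower_obj \<times> 'm")

text \<open>
  The copy of \<open>C\<close> obtained by renaming objects along an injection \<open>e\<close> with left inverse \<open>d\<close>,
  and the isomorphisms between the category and its copy.
\<close>

definition rename_cat :: "('o \<Rightarrow> 'p) \<Rightarrow> ('p \<Rightarrow> 'o) \<Rightarrow> ('o, 'm) cat \<Rightarrow> ('p, 'm) cat" where
  "rename_cat e d C =
     \<lparr>Obj = e ` Obj C, Hom = (\<lambda>p q. Hom C (d p) (d q)), Ident = (\<lambda>p. Ident C (d p)), Comp = Comp C\<rparr>"

definition rename_func :: "('o \<Rightarrow> 'p) \<Rightarrow> ('o, 'm, 'p, 'm) func" where
  "rename_func e = \<lparr>FObj = e, FHom = (\<lambda>a b f. f)\<rparr>"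

text \<open>
  LAdj adjoints are only determined up to isomorphism, so the tower of \<open>G\<close> depends on a sequence
  \<open>J\<close> of adjunction data, \<open>J k\<close> being the data of a left adjoint of the \<open>k\<close>-th comparison functor.
  \<open>tower A G J k\<close> is the pair of the \<open>k\<close>-th category and the \<open>k\<close>-th functor into it.
\<close>

primrec tower ::
    "('o, 'm) cat \<Rightarrow> ('x, 'y, 'o, 'm) func \<Rightarrow> (nat \<Rightarrow> (('o, 'm) tower_obj, 'm, 'x, 'y) adj_data) \<Rightarrow>
     nat \<Rightarrow> (('o, 'm) tower_obj, 'm) cat \<times> ('x, 'y, ('o, 'm) tower_obj, 'm) func" where
  "tower A G J 0 = (rename_cat Base unBase A, rename_func Base \<circ>\<^sub>F G)"
| "tower A G J (Suc k) =
     (let A\<^sub>k = fst (tower A G J k); G\<^sub>k = snd (tower A G J k)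
      in (rename_cat Alg unAlg (EM A\<^sub>k (induced_monad G\<^sub>k (J k))),
          rename_func Alg \<circ>\<^sub>F comparison G\<^sub>k (J k)))"

abbreviation tower_cat ::
    "('o, 'm) cat \<Rightarrow> ('x, 'y, 'o, 'm) func \<Rightarrow> (nat \<Rightarrow> (('o, 'm) tower_obj, 'm, 'x, 'y) adj_data) \<Rightarrow>
     nat \<Rightarrow> (('o, 'm) tower_obj, 'm) cat" where
  "tower_cat A G J k \<equiv> fst (tower A G J k)"

abbreviation tower_func ::
    "('o, 'm) cat \<Rightarrow> ('x, 'y, 'o, 'm) func \<Rightarrow> (nat \<Rightarrow> (('o, 'm) tower_obj, 'm, 'x, 'y) adj_data) \<Rightarrow>
     nat \<Rightarrow> ('x, 'y, ('o, 'm) tower_obj, 'm) func" where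
  "tower_func A G J k \<equiv> snd (tower A G J k)"

text \<open>From step \<open>Suc k\<close> to step \<open>k\<close>; the same expression for every \<open>k\<close>.\<close>

definition tower_forget :: "(('o, 'm) tower_obj, 'm, ('o, 'm) tower_obj, 'm) func" where
  "tower_forget = EM_forget \<circ>\<^sub>F rename_func unAlg"

text \<open>
  A sequence \<open>J\<close> with the following property exists if and only if the monadic tower exists
  for any finite step.
\<close>

definition tower_adjunctions ::
    "('x, 'y) cat \<Rightarrow> ('o, 'm) cat \<Rightarrow> ('x, 'y, 'o, 'm) func \<Rightarrow>
     (nat \<Rightarrow> (('o, 'm) tower_obj, 'm, 'x, 'y) adj_data) \<Rightarrow> bool" where
  "tower_adjunctions X A G J \<longleftrightarrow>
     (\<forall>k. adjunction X (tower_cat A G J k) (tower_func A G J k) (J k))"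

definition tower_stabilizes_at ::
    "('o, 'm) cat \<Rightarrow> ('x, 'y, 'o, 'm) func \<Rightarrow> (nat \<Rightarrow> (('o, 'm) tower_obj, 'm, 'x, 'y) adj_data) \<Rightarrow>
     nat \<Rightarrow> bool" where
  "tower_stabilizes_at A G J k \<longleftrightarrow>
     (\<forall>j\<ge>k. cat_isomorphism (tower_cat A G J (Suc j)) (tower_cat A G J j) tower_forget)"

end

theory Submission
  imports Defs
begin

text \<open>
  Write \<open>V\<^sub>k : A\<^sub>k\<^sub>+\<^sub>1 \<rightarrow> A\<^sub>k\<close> for the forgetful functors of the tower, \<open>F\<^sub>k \<stileturn> G\<^sub>k\<close> for its adjunctions
  and \<open>\<eta>\<^sub>k : 1 \<rightarrow> G\<^sub>k F\<^sub>k\<close> for their units, and let \<open>L \<stileturn> R\<close> be the adjunction of the coreflection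
  \<open>R : X \<rightarrow> B\<^sub>n\<close>. If \<open>\<eta>\<^sub>n\<close> is invertible, then every object of \<open>A\<^sub>n\<close> carries exactly one algebra
  structure, the inverse of its unit, so that \<open>V\<^sub>n\<close> is an isomorphism; and \<open>\<eta>\<^sub>n\<^sub>+\<^sub>1\<close> is invertible as
  well, so that the argument can be repeated (\<open>forget_isomorphism\<close>, \<open>step_unit_iso\<close>). The theorem
  therefore follows once \<open>\<eta>\<^sub>n\<close> is known to be invertible. Three facts give this.

  The first is that the tower maps to the given decomposition. There are functors
  \<open>N\<^sub>k : A\<^sub>k \<rightarrow> B\<^sub>k\<close> with \<open>N\<^sub>k G\<^sub>k = U\<^sub>k\<^sub>+\<^sub>1 \<dots> U\<^sub>n R\<close> and \<open>U\<^sub>k\<^sub>+\<^sub>1 N\<^sub>k\<^sub>+\<^sub>1 = N\<^sub>k V\<^sub>k\<close>. To define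
  \<open>N\<^sub>k\<^sub>+\<^sub>1\<close> on an algebra \<open>(a, h)\<close>, one uses that \<open>h\<close> is the split coequalizer of \<open>G\<^sub>k \<epsilon>\<close> and
  \<open>G\<^sub>k F\<^sub>k h\<close>. Its image under \<open>N\<^sub>k\<close> is a split coequalizer of a pair in the image of \<open>U\<^sub>k\<^sub>+\<^sub>1\<close>, and by
  Beck's theorem \<open>U\<^sub>k\<^sub>+\<^sub>1\<close> creates such coequalizers (\<open>strictly_monadic_beck\<close>, \<open>lift_to_step\<close>). All
  \<open>N\<^sub>k\<close> are faithful and conservative because the forgetful functors are.

  The second is that every \<open>F\<^sub>k\<close> takes its values in the coreflective subcategory of \<open>X\<close> given by \<open>L\<close>,
  that is, in the objects at which the counit of \<open>L \<stileturn> R\<close> is invertible. For \<open>k = 0\<close> this holds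
  because \<open>G\<close> factors through \<open>R\<close> (\<open>counit_iso_at_left_adjoint\<close>). For the step, \<open>F\<^sub>k\<^sub>+\<^sub>1 (a, h)\<close> is the
  coequalizer in \<open>X\<close> of \<open>\<epsilon>\<close> and \<open>F\<^sub>k h\<close> from \<open>F\<^sub>k G\<^sub>k F\<^sub>k a\<close> to \<open>F\<^sub>k a\<close>, and coreflective subcategories
  are closed under coequalizers (\<open>quotient_universal\<close>, \<open>counit_iso_at_step_left_adjoint\<close>).

  The third is that, since \<open>N\<^sub>n\<close> is faithful and conservative with \<open>N\<^sub>n G\<^sub>n = R\<close>, it suffices to find
  \<open>u : F\<^sub>n c \<rightarrow> L N\<^sub>n c\<close> such that \<open>R u\<close> composed with \<open>N\<^sub>n \<eta>\<^sub>n : N\<^sub>n c \<rightarrow> R F\<^sub>n c\<close> is the unit of \<open>L \<stileturn> R\<close>: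
  then \<open>N\<^sub>n \<eta>\<^sub>n\<close> has a retraction, and the retraction is an inverse because all endomorphisms of
  \<open>R F\<^sub>n c\<close> come from \<open>X\<close> (\<open>unit_iso_if_factor\<close>). For \<open>n > 0\<close> such a \<open>u\<close> is obtained from the
  description of \<open>F\<^sub>n c\<close> as a coequalizer (\<open>unit_iso_at_lift\<close>); for \<open>n = 0\<close> it exists because
  \<open>N\<^sub>0\<close> is an isomorphism.
\<close>

section \<open>Arrows with source and target\<close>

text \<open>
  A morphism in the sense of the given definition does not determine its source and target. Bundling
  it with them turns the side conditions of composition into equations between objects, which the
  simplifier can decide; all diagram chases below are carried out with such arrows.
\<close>

datatype ('o, 'm) arrow = Arrow (src: 'o) (mor: 'm) (tgt: 'o)

lemma arrow_eqI: "src f = src g \<Longrightarrow> mor f = mor g \<Longrightarrow> tgt f = tgt g \<Longrightarrow> f = g"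
  by (simp add: arrow.expand)

definition arr :: "('o, 'm) cat \<Rightarrow> ('o, 'm) arrow \<Rightarrow> bool" where
  "arr C f \<longleftrightarrow> src f \<in> Obj C \<and> tgt f \<in> Obj C \<and> mor f \<in> Hom C (src f) (tgt f)"

definition cmp :: "('o, 'm) cat \<Rightarrow> ('o, 'm) arrow \<Rightarrow> ('o, 'm) arrow \<Rightarrow> ('o, 'm) arrow"
    (infixr \<open>\<cdot>\<index>\<close> 70) where
  "g \<cdot>\<^bsub>C\<^esub> f = Arrow (src f) (Comp C (mor g) (mor f)) (tgt g)"

definition ide :: "('o, 'm) cat \<Rightarrow> 'o \<Rightarrow> ('o, 'm) arrow" where
  "ide C a = Arrow a (Ident C a) a"

definition amap :: "('o, 'm, 'p, 'q) func \<Rightarrow> ('o, 'm) arrow \<Rightarrow> ('p, 'q) arrow"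
    (infixr \<open>\<star>\<close> 80) where
  "F \<star> f = Arrow (FObj F (src f)) (FHom F (src f) (tgt f) (mor f)) (FObj F (tgt f))"

lemma src_tgt_simps [simp]:
  "src (g \<cdot>\<^bsub>C\<^esub> f) = src f" "tgt (g \<cdot>\<^bsub>C\<^esub> f) = tgt g"
  "src (ide C a) = a" "tgt (ide C a) = a"
  "src (F \<star> f) = FObj F (src f)" "tgt (F \<star> f) = FObj F (tgt f)"
  by (simp_all add: cmp_def ide_def amap_def)

lemma arr_src: "arr C f \<Longrightarrow> src f \<in> Obj C"
  and arr_tgt: "arr C f \<Longrightarrow> tgt f \<in> Obj C"
  by (simp_all add: arr_def)

lemma amap_comp_func: "(K \<circ>\<^sub>F H) \<star> f = K \<star> H \<star> f"
  and FObj_comp_func: "FObj (K \<circ>\<^sub>F H) a = FObj K (FObj H a)"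
  and amap_id_func [simp]: "id_func \<star> f = f"
  and FObj_id_func [simp]: "FObj id_func a = a"
  by (simp_all add: comp_func_def amap_def id_func_def)

context category
begin

lemma arr_ide [simp]: "a \<in> Obj C \<Longrightarrow> arr C (ide C a)"
  by (simp add: arr_def ide_def id_in_hom)

lemma arr_cmp [simp]: "arr C f \<Longrightarrow> arr C g \<Longrightarrow> tgt f = src g \<Longrightarrow> arr C (g \<cdot>\<^bsub>C\<^esub> f)"
  using comp_in_hom[of "src f" "tgt f" "tgt g" "mor f" "mor g"] by (simp add: arr_def cmp_def)

lemma cmp_ide_right [simp]: "arr C f \<Longrightarrow> src f = a \<Longrightarrow> f \<cdot>\<^bsub>C\<^esub> ide C a = f"
  and cmp_ide_left [simp]: "arr C f \<Longrightarrow> tgt f = b \<Longrightarrow> ide C b \<cdot>\<^bsub>C\<^esub> f = f"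
  by (auto intro!: arrow_eqI simp: arr_def cmp_def ide_def comp_id_right comp_id_left)

lemma cmp_assoc [simp]:
  "\<lbrakk>arr C f; arr C g; arr C h; tgt f = src g; tgt g = src h\<rbrakk>
    \<Longrightarrow> (h \<cdot>\<^bsub>C\<^esub> g) \<cdot>\<^bsub>C\<^esub> f = h \<cdot>\<^bsub>C\<^esub> g \<cdot>\<^bsub>C\<^esub> f"
  using comp_assoc[of "src f" "tgt f" "tgt g" "tgt h" "mor f" "mor g" "mor h"]
  by (simp add: arr_def cmp_def)

text \<open>The simplifier works with composites bracketed to the right, where the left-hand side of an
  equation can only occur followed by a further factor.\<close>

lemma cmp_reassoc:
  assumes "h \<cdot>\<^bsub>C\<^esub> g = k" "arr C g" "arr C h" "tgt g = src h" "arr C f" "tgt f = src g"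
  shows "h \<cdot>\<^bsub>C\<^esub> g \<cdot>\<^bsub>C\<^esub> f = k \<cdot>\<^bsub>C\<^esub> f"
  using assms by (metis cmp_assoc)

end

lemma (in category) func_eq_on_iff: "func_eq_on C F G \<longleftrightarrow> (\<forall>f. arr C f \<longrightarrow> F \<star> f = G \<star> f)"
proof
  assume "func_eq_on C F G"
  then show "\<forall>f. arr C f \<longrightarrow> F \<star> f = G \<star> f"
    by (auto simp: func_eq_on_def arr_def amap_def)
next
  assume eq: "\<forall>f. arr C f \<longrightarrow> F \<star> f = G \<star> f"
  have obj: "FObj F a = FObj G a" if "a \<in> Obj C" for a
    using eq[rule_format, OF arr_ide[OF that]] by (simp add: amap_def ide_def)
  have "FHom F a b m = FHom G a b m" if "a \<in> Obj C" "b \<in> Obj C" "m \<in> Hom C a b" for a b m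
    using eq[rule_format, of "Arrow a m b"] that by (simp add: amap_def arr_def)
  with obj show "func_eq_on C F G" by (simp add: func_eq_on_def)
qed

lemma func_eq_on_obj: "func_eq_on C F G \<Longrightarrow> a \<in> Obj C \<Longrightarrow> FObj F a = FObj G a"
  by (simp add: func_eq_on_def)

context cat_functor
begin

lemma FObj_in_Obj [simp]: "a \<in> Obj C \<Longrightarrow> FObj F a \<in> Obj D"
  by (rule fobj_in_obj)

lemma arr_amap [simp]: "arr C f \<Longrightarrow> arr D (F \<star> f)"
  by (simp add: arr_def amap_def fobj_in_obj fhom_in_hom)

lemma amap_ide [simp]: "a \<in> Obj C \<Longrightarrow> F \<star> ide C a = ide D (FObj F a)"
  by (simp add: ide_def amap_def fhom_id)

lemma amap_cmp [simp]:
  "arr C f \<Longrightarrow> arr C g \<Longrightarrow> tgt f = src g \<Longrightarrow> F \<star> (g \<cdot>\<^bsub>C\<^esub> f) = (F \<star> g) \<cdot>\<^bsub>D\<^esub> (F \<star> f)"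
  using fhom_comp[of "src f" "tgt f" "tgt g" "mor f" "mor g"]
  by (simp add: arr_def cmp_def amap_def)

end

lemma cat_functor_comp:
  assumes "cat_functor C D H" "cat_functor D E K"
  shows "cat_functor C E (K \<circ>\<^sub>F H)"
proof -
  interpret H: cat_functor C D H by fact
  interpret K: cat_functor D E K by fact
  show ?thesis
    by unfold_locales
      (auto simp: comp_func_def H.fobj_in_obj H.fhom_in_hom H.fhom_id H.fhom_comp
        K.fobj_in_obj K.fhom_in_hom K.fhom_id intro: K.fhom_comp)
qed

lemma cat_functor_arrI:
  assumes "category C" "category D"
    and "\<And>a. a \<in> Obj C \<Longrightarrow> FObj F a \<in> Obj D"
    and arr: "\<And>f. arr C f \<Longrightarrow> arr D (F \<star> f)"
    and ide: "\<And>a. a \<in> Obj C \<Longrightarrow> F \<star> ide C a = ide D (FObj F a)"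
    and cmp: "\<And>f g. arr C f \<Longrightarrow> arr C g \<Longrightarrow> tgt f = src g \<Longrightarrow>
      F \<star> (g \<cdot>\<^bsub>C\<^esub> f) = (F \<star> g) \<cdot>\<^bsub>D\<^esub> (F \<star> f)"
  shows "cat_functor C D F"
proof -
  interpret C: category C by fact
  interpret D: category D by fact
  show ?thesis
  proof
    fix a assume "a \<in> Obj C"
    with assms(3) show "FObj F a \<in> Obj D" by simp
    show "FHom F a a (Ident C a) = Ident D (FObj F a)"
      using ide[OF \<open>a \<in> Obj C\<close>] by (simp add: ide_def amap_def)
  next
    fix a b f assume "a \<in> Obj C" "b \<in> Obj C" "f \<in> Hom C a b"
    then show "FHom F a b f \<in> Hom D (FObj F a) (FObj F b)"
      using arr[of "Arrow a f b"] by (simp add: arr_def amap_def)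
  next
    fix a b c f g
    assume "a \<in> Obj C" "b \<in> Obj C" "c \<in> Obj C" "f \<in> Hom C a b" "g \<in> Hom C b c"
    then show "FHom F a c (Comp C g f) = Comp D (FHom F b c g) (FHom F a b f)"
      using cmp[of "Arrow a f b" "Arrow b g c"] by (simp add: arr_def cmp_def amap_def)
  qed
qed

definition inverse_arrows :: "('o, 'm) cat \<Rightarrow> ('o, 'm) arrow \<Rightarrow> ('o, 'm) arrow \<Rightarrow> bool" where
  "inverse_arrows C f g \<longleftrightarrow> arr C f \<and> arr C g \<and> src g = tgt f \<and> tgt g = src f \<and>
     g \<cdot>\<^bsub>C\<^esub> f = ide C (src f) \<and> f \<cdot>\<^bsub>C\<^esub> g = ide C (tgt f)"

definition invertible :: "('o, 'm) cat \<Rightarrow> ('o, 'm) arrow \<Rightarrow> bool" where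
  "invertible C f \<longleftrightarrow> (\<exists>g. inverse_arrows C f g)"

lemma (in cat_functor) invertible_amap: "invertible C f \<Longrightarrow> invertible D (F \<star> f)"
proof -
  assume "invertible C f"
  then obtain g where g: "arr C f" "arr C g" "src g = tgt f" "tgt g = src f"
    "g \<cdot>\<^bsub>C\<^esub> f = ide C (src f)" "f \<cdot>\<^bsub>C\<^esub> g = ide C (tgt f)"
    by (auto simp: invertible_def inverse_arrows_def)
  have "inverse_arrows D (F \<star> f) (F \<star> g)"
    using g amap_cmp[of f g] amap_cmp[of g f] by (simp add: inverse_arrows_def arr_src arr_tgt)
  then show ?thesis unfolding invertible_def by blast
qed

definition faithful :: "('o, 'm) cat \<Rightarrow> ('o, 'm, 'p, 'q) func \<Rightarrow> bool" where
  "faithful C F \<longleftrightarrow> (\<forall>f g. arr C f \<longrightarrow> arr C g \<longrightarrow> src f = src g \<longrightarrow> tgt f = tgt g \<longrightarrow>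
     F \<star> f = F \<star> g \<longrightarrow> f = g)"

definition conservative :: "('o, 'm) cat \<Rightarrow> ('p, 'q) cat \<Rightarrow> ('o, 'm, 'p, 'q) func \<Rightarrow> bool" where
  "conservative C D F \<longleftrightarrow> (\<forall>f. arr C f \<longrightarrow> invertible D (F \<star> f) \<longrightarrow> invertible C f)"

lemma faithfulD:
  "faithful C F \<Longrightarrow> arr C f \<Longrightarrow> arr C g \<Longrightarrow> src f = src g \<Longrightarrow> tgt f = tgt g \<Longrightarrow> F \<star> f = F \<star> g \<Longrightarrow> f = g"
  by (simp add: faithful_def)


section \<open>Adjunctions\<close>

definition unit_arr :: "('x, 'y, 'o, 'm) func \<Rightarrow> ('o, 'm, 'x, 'y) adj_data \<Rightarrow> 'o \<Rightarrow> ('o, 'm) arrow" where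
  "unit_arr G J a = Arrow a (Unit J a) (FObj G (FObj (LAdj J) a))"

definition counit_arr :: "('x, 'y, 'o, 'm) func \<Rightarrow> ('o, 'm, 'x, 'y) adj_data \<Rightarrow> 'x \<Rightarrow> ('x, 'y) arrow" where
  "counit_arr G J x = Arrow (FObj (LAdj J) (FObj G x)) (Counit J x) x"

lemma src_tgt_unit [simp]:
  "src (unit_arr G J a) = a" "tgt (unit_arr G J a) = FObj G (FObj (LAdj J) a)"
  "src (counit_arr G J x) = FObj (LAdj J) (FObj G x)" "tgt (counit_arr G J x) = x"
  by (simp_all add: unit_arr_def counit_arr_def)

context adjunction
begin

abbreviation L :: "('o, 'm, 'x, 'y) func" where "L \<equiv> LAdj J"
abbreviation \<eta> :: "'o \<Rightarrow> ('o, 'm) arrow" where "\<eta> \<equiv> unit_arr G J"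
abbreviation \<epsilon> :: "'x \<Rightarrow> ('x, 'y) arrow" where "\<epsilon> \<equiv> counit_arr G J"

lemma arr_unit [simp]: "a \<in> Obj A \<Longrightarrow> arr A (\<eta> a)"
  using unit_in_hom by (simp add: arr_def unit_arr_def comp_func_def)

lemma arr_counit [simp]: "x \<in> Obj X \<Longrightarrow> arr X (\<epsilon> x)"
  using counit_in_hom by (simp add: arr_def counit_arr_def comp_func_def)

lemma unit_nat: "arr A f \<Longrightarrow> src f = a \<Longrightarrow> (G \<star> L \<star> f) \<cdot>\<^bsub>A\<^esub> \<eta> a = \<eta> (tgt f) \<cdot>\<^bsub>A\<^esub> f"
  using unit_natural[of "src f" "tgt f" "mor f"]
  by (auto intro!: arrow_eqI simp: arr_def unit_arr_def cmp_def amap_def comp_func_def)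

lemma counit_nat: "arr X g \<Longrightarrow> tgt g = y \<Longrightarrow> \<epsilon> y \<cdot>\<^bsub>X\<^esub> (L \<star> G \<star> g) = g \<cdot>\<^bsub>X\<^esub> \<epsilon> (src g)"
  using counit_natural[of "src g" "tgt g" "mor g"]
  by (auto intro!: arrow_eqI simp: arr_def counit_arr_def cmp_def amap_def comp_func_def)

lemma triangle_L [simp]: "a \<in> Obj A \<Longrightarrow> \<epsilon> (FObj L a) \<cdot>\<^bsub>X\<^esub> (L \<star> \<eta> a) = ide X (FObj L a)"
  using triangle_left[of a]
  by (auto intro!: arrow_eqI simp: unit_arr_def counit_arr_def cmp_def amap_def comp_func_def ide_def)

lemma triangle_G [simp]: "x \<in> Obj X \<Longrightarrow> (G \<star> \<epsilon> x) \<cdot>\<^bsub>A\<^esub> \<eta> (FObj G x) = ide A (FObj G x)"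
  using triangle_right[of x]
  by (auto intro!: arrow_eqI simp: unit_arr_def counit_arr_def cmp_def amap_def comp_func_def ide_def)

end

text \<open>
  These two rules become rewrite rules only here: they loop together with the definition of \<open>arr\<close>,
  which the proofs up to this point unfold.
\<close>

declare arr_src [simp] arr_tgt [simp]

context adjunction
begin

lemma triangle_G_reassoc [simp]:
  assumes "x \<in> Obj X" "arr A f" "tgt f = FObj G x"
  shows "(G \<star> \<epsilon> x) \<cdot>\<^bsub>A\<^esub> \<eta> (FObj G x) \<cdot>\<^bsub>A\<^esub> f = f"
  using right.target.cmp_reassoc[OF triangle_G] assms by simp

lemma transpose:
  assumes "a \<in> Obj A" "x \<in> Obj X" "arr A f" "src f = a" "tgt f = FObj G x"
  shows "(G \<star> (\<epsilon> x \<cdot>\<^bsub>X\<^esub> (L \<star> f))) \<cdot>\<^bsub>A\<^esub> \<eta> a = f"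
  using assms by (simp add: unit_nat)

lemma transpose_transpose:
  assumes "a \<in> Obj A" "arr X g" "src g = FObj L a"
  shows "\<epsilon> (tgt g) \<cdot>\<^bsub>X\<^esub> (L \<star> ((G \<star> g) \<cdot>\<^bsub>A\<^esub> \<eta> a)) = g"
proof -
  have "\<epsilon> (tgt g) \<cdot>\<^bsub>X\<^esub> (L \<star> G \<star> g) \<cdot>\<^bsub>X\<^esub> (L \<star> \<eta> a) = (g \<cdot>\<^bsub>X\<^esub> \<epsilon> (src g)) \<cdot>\<^bsub>X\<^esub> (L \<star> \<eta> a)"
    using assms by (intro right.source.cmp_reassoc counit_nat) auto
  then show ?thesis using assms by simp
qed

lemma eq_if_transpose_eq:
  assumes "a \<in> Obj A" "arr X g" "src g = FObj L a" "arr X h" "src h = FObj L a" "tgt g = tgt h"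
    and "(G \<star> g) \<cdot>\<^bsub>A\<^esub> \<eta> a = (G \<star> h) \<cdot>\<^bsub>A\<^esub> \<eta> a"
  shows "g = h"
  using transpose_transpose[of a g] transpose_transpose[of a h] assms by simp

end

section \<open>Strictly monadic functors create split coequalizers\<close>

context adjunction
begin

lemma is_algebra_iff:
  fixes a h
  defines "\<alpha> \<equiv> Arrow (FObj G (FObj L a)) h a"
  shows "is_algebra A (induced_monad G J) a h \<longleftrightarrow>
     arr A \<alpha> \<and> \<alpha> \<cdot>\<^bsub>A\<^esub> \<eta> a = ide A a \<and>
     \<alpha> \<cdot>\<^bsub>A\<^esub> (G \<star> \<epsilon> (FObj L a)) = \<alpha> \<cdot>\<^bsub>A\<^esub> (G \<star> L \<star> \<alpha>)"
  unfolding is_algebra_def \<alpha>_def induced_monad_def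
  by (auto simp: arr_def unit_arr_def counit_arr_def cmp_def amap_def comp_func_def ide_def
      simp del: arr_src arr_tgt)

definition structure_arr :: "'o \<times> 'm \<Rightarrow> ('o, 'm) arrow" where
  "structure_arr p = Arrow (FObj G (FObj L (fst p))) (snd p) (fst p)"

lemma src_tgt_structure_arr [simp]:
  "src (structure_arr p) = FObj G (FObj L (fst p))" "tgt (structure_arr p) = fst p"
  by (simp_all add: structure_arr_def)

lemma structure_arr_inject: "structure_arr p = structure_arr p' \<Longrightarrow> p = p'"
  by (simp add: structure_arr_def prod_eq_iff)

lemma Obj_EM_iff:
  "p \<in> Obj (EM A (induced_monad G J)) \<longleftrightarrow>
     arr A (structure_arr p) \<and> structure_arr p \<cdot>\<^bsub>A\<^esub> \<eta> (fst p) = ide A (fst p) \<and>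
     structure_arr p \<cdot>\<^bsub>A\<^esub> (G \<star> \<epsilon> (FObj L (fst p))) = structure_arr p \<cdot>\<^bsub>A\<^esub> (G \<star> L \<star> structure_arr p)"
  using is_algebra_iff[of "fst p" "snd p"]
  by (simp add: EM_def structure_arr_def case_prod_beta)

lemma arr_EM_iff:
  fixes f
  defines "f' \<equiv> Arrow (fst (src f)) (mor f) (fst (tgt f))"
  shows "arr (EM A (induced_monad G J)) f \<longleftrightarrow>
     src f \<in> Obj (EM A (induced_monad G J)) \<and> tgt f \<in> Obj (EM A (induced_monad G J)) \<and> arr A f' \<and>
     f' \<cdot>\<^bsub>A\<^esub> structure_arr (src f) = structure_arr (tgt f) \<cdot>\<^bsub>A\<^esub> (G \<star> L \<star> f')"
  unfolding f'_def structure_arr_def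
  by (auto simp: arr_def EM_def cmp_def amap_def induced_monad_def comp_func_def case_prod_beta
      is_algebra_def simp del: arr_src arr_tgt)

lemma structure_arr_comparison [simp]:
  "structure_arr (FObj (comparison G J) x) = G \<star> \<epsilon> x"
  by (simp add: structure_arr_def comparison_def amap_def counit_arr_def comp_func_def)

lemma fst_comparison [simp]: "fst (FObj (comparison G J) x) = FObj G x"
  by (simp add: comparison_def)

lemma mor_comparison [simp]: "mor (comparison G J \<star> f) = mor (G \<star> f)"
  by (simp add: comparison_def amap_def)

end

definition split_coequalizer ::
    "('o, 'm) cat \<Rightarrow> ('o, 'm) arrow \<Rightarrow> ('o, 'm) arrow \<Rightarrow> ('o, 'm) arrow \<Rightarrow>
     ('o, 'm) arrow \<Rightarrow> ('o, 'm) arrow \<Rightarrow> bool" where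
  "split_coequalizer C f g q s t \<longleftrightarrow>
     arr C q \<and> arr C s \<and> arr C t \<and> src q = tgt f \<and> src s = tgt q \<and> tgt s = src q \<and>
     src t = tgt f \<and> tgt t = src f \<and> q \<cdot>\<^bsub>C\<^esub> f = q \<cdot>\<^bsub>C\<^esub> g \<and>
     q \<cdot>\<^bsub>C\<^esub> s = ide C (tgt q) \<and> f \<cdot>\<^bsub>C\<^esub> t = ide C (tgt f) \<and> g \<cdot>\<^bsub>C\<^esub> t = s \<cdot>\<^bsub>C\<^esub> q"

definition coequalizes ::
    "('o, 'm) cat \<Rightarrow> ('o, 'm) arrow \<Rightarrow> ('o, 'm) arrow \<Rightarrow> ('o, 'm) arrow \<Rightarrow> bool" where
  "coequalizes C f g h \<longleftrightarrow> arr C h \<and> src h = tgt f \<and> h \<cdot>\<^bsub>C\<^esub> f = h \<cdot>\<^bsub>C\<^esub> g"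

text \<open>
  The lift \<open>p\<close> is unique as an arrow, hence so is the object at which it ends. This strict form of
  creation makes lifted functors agree with given ones on the nose.
\<close>

definition creates_split_coequalizers ::
    "('p, 'q) cat \<Rightarrow> ('o, 'm) cat \<Rightarrow> ('p, 'q, 'o, 'm) func \<Rightarrow> bool" where
  "creates_split_coequalizers B D U \<longleftrightarrow>
     (\<forall>f g q s t. arr B f \<longrightarrow> arr B g \<longrightarrow> src f = src g \<longrightarrow> tgt f = tgt g \<longrightarrow>
        split_coequalizer D (U \<star> f) (U \<star> g) q s t \<longrightarrow>
        (\<exists>!p. arr B p \<and> src p = tgt f \<and> U \<star> p = q) \<and>
        (\<forall>p. arr B p \<longrightarrow> src p = tgt f \<longrightarrow> U \<star> p = q \<longrightarrow> coequalizes B f g p \<and>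
          (\<forall>h. coequalizes B f g h \<longrightarrow>
            (\<exists>u. arr B u \<and> src u = tgt p \<and> tgt u = tgt h \<and> u \<cdot>\<^bsub>B\<^esub> p = h))))"

lemma (in category) split_epi_cancel:
  assumes "q \<cdot>\<^bsub>C\<^esub> s = ide C (tgt q)" "arr C q" "arr C s" "tgt s = src q"
    and "arr C u" "arr C v" "src u = tgt q" "src v = tgt q" "u \<cdot>\<^bsub>C\<^esub> q = v \<cdot>\<^bsub>C\<^esub> q"
  shows "u = v"
proof -
  have "u = u \<cdot>\<^bsub>C\<^esub> q \<cdot>\<^bsub>C\<^esub> s" using assms by simp
  also have "\<dots> = (u \<cdot>\<^bsub>C\<^esub> q) \<cdot>\<^bsub>C\<^esub> s" using assms(2-7) by simp
  also have "\<dots> = v \<cdot>\<^bsub>C\<^esub> q \<cdot>\<^bsub>C\<^esub> s" unfolding assms(9) using assms(2-8) by simp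
  also have "\<dots> = v" using assms by simp
  finally show ?thesis .
qed

context
  fixes B :: "('p, 'q) cat" and D :: "('o, 'm) cat" and U J
  assumes adj: "adjunction B D U J"
    and K_iso: "cat_isomorphism B (EM D (induced_monad U J)) (comparison U J)"
begin

interpretation U: adjunction B D U J by (rule adj)

interpretation K: cat_functor B "EM D (induced_monad U J)" "comparison U J"
  using K_iso by (simp add: cat_isomorphism_def)

lemma comparison_iso_inverse:
  obtains K' where "cat_functor (EM D (induced_monad U J)) B K'"
    "\<And>f. arr B f \<Longrightarrow> K' \<star> comparison U J \<star> f = f"
    "\<And>f. arr (EM D (induced_monad U J)) f \<Longrightarrow> comparison U J \<star> K' \<star> f = f"
    "\<And>x. x \<in> Obj B \<Longrightarrow> FObj K' (FObj (comparison U J) x) = x"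
    "\<And>p. p \<in> Obj (EM D (induced_monad U J)) \<Longrightarrow> FObj (comparison U J) (FObj K' p) = p"
proof -
  obtain K' where K': "cat_functor (EM D (induced_monad U J)) B K'"
      "func_eq_on B (K' \<circ>\<^sub>F comparison U J) id_func"
      "func_eq_on (EM D (induced_monad U J)) (comparison U J \<circ>\<^sub>F K') id_func"
    using K_iso unfolding cat_isomorphism_def by blast
  show ?thesis
  proof (rule that[OF K'(1)])
    show "K' \<star> comparison U J \<star> f = f" if "arr B f" for f
      using K'(2) that by (simp add: U.right.source.func_eq_on_iff amap_comp_func)
    show "comparison U J \<star> K' \<star> f = f" if "arr (EM D (induced_monad U J)) f" for f
      using K'(3) that by (simp add: K.target.func_eq_on_iff amap_comp_func)
    show "FObj K' (FObj (comparison U J) x) = x" if "x \<in> Obj B" for x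
      using func_eq_on_obj[OF K'(2) that] by (simp add: FObj_comp_func)
    show "FObj (comparison U J) (FObj K' p) = p" if "p \<in> Obj (EM D (induced_monad U J))" for p
      using func_eq_on_obj[OF K'(3) that] by (simp add: FObj_comp_func)
  qed
qed

lemma comparison_iso_faithful: "faithful B U"
  unfolding faithful_def
proof (intro allI impI)
  fix f g assume fg: "arr B f" "arr B g" "src f = src g" "tgt f = tgt g" "U \<star> f = U \<star> g"
  obtain K' where "cat_functor (EM D (induced_monad U J)) B K'" and K': "\<And>f. arr B f \<Longrightarrow> K' \<star> comparison U J \<star> f = f"
    by (rule comparison_iso_inverse) blast
  have "comparison U J \<star> f = comparison U J \<star> g"
    using fg by (intro arrow_eqI) simp_all
  then show "f = g" using K' fg by metis
qed

lemma comparison_iso_eqI: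
  assumes "z \<in> Obj B" "z' \<in> Obj B" "U \<star> U.\<epsilon> z = U \<star> U.\<epsilon> z'"
  shows "z = z'"
proof -
  obtain K' where "cat_functor (EM D (induced_monad U J)) B K'" and K': "\<And>x. x \<in> Obj B \<Longrightarrow> FObj K' (FObj (comparison U J) x) = x"
    by (rule comparison_iso_inverse) blast
  have "FObj (comparison U J) z = FObj (comparison U J) z'"
    using assms(3) by (intro U.structure_arr_inject) simp
  then show ?thesis using K' assms by metis
qed

lemma counit_image_nat:
  assumes "arr B f" "tgt f = y"
  shows "(U \<star> U.\<epsilon> y) \<cdot>\<^bsub>D\<^esub> (U \<star> U.L \<star> U \<star> f) = (U \<star> f) \<cdot>\<^bsub>D\<^esub> (U \<star> U.\<epsilon> (src f))"
proof -
  have "U \<star> (U.\<epsilon> y \<cdot>\<^bsub>B\<^esub> (U.L \<star> U \<star> f)) = U \<star> (f \<cdot>\<^bsub>B\<^esub> U.\<epsilon> (src f))"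
    using assms by (simp only: U.counit_nat)
  then show ?thesis using assms arr_tgt[OF assms(1)] by simp
qed

text \<open>
  This is the half of Beck's theorem that produces lifts. Let \<open>q : U y \<rightarrow> c\<close> be the split
  coequalizer, with section \<open>s\<close>. If \<open>q\<close> is to be a morphism of algebras, the structure of \<open>c\<close> has
  to be the structure \<open>\<theta>\<close> of \<open>y\<close> transported along \<open>q\<close> and \<open>s\<close>. The splitting makes it an
  algebra, and the isomorphism with the Eilenberg--Moore category turns it into an object of \<open>B\<close>.
\<close>

lemma comparison_iso_creates:
  assumes f: "arr B f" and g: "arr B g" and par: "src f = src g" "tgt f = tgt g"
    and split: "split_coequalizer D (U \<star> f) (U \<star> g) q s t"
  shows "\<exists>!p. arr B p \<and> src p = tgt f \<and> U \<star> p = q"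
    and "\<lbrakk>arr B p; src p = tgt f; U \<star> p = q\<rbrakk> \<Longrightarrow> coequalizes B f g p"
    and "\<lbrakk>arr B p; src p = tgt f; U \<star> p = q; coequalizes B f g h\<rbrakk>
      \<Longrightarrow> \<exists>u. arr B u \<and> src u = tgt p \<and> tgt u = tgt h \<and> u \<cdot>\<^bsub>B\<^esub> p = h"
proof -
  let ?EM = "EM D (induced_monad U J)" and ?K = "comparison U J"
  define x y c where "x = src f" and "y = tgt f" and "c = tgt q"
  define \<theta> where "\<theta> = (\<lambda>b. U \<star> U.\<epsilon> b)"
  have x: "x \<in> Obj B" "src f = x" "src g = x" and y: "y \<in> Obj B" "tgt f = y" "tgt g = y"
    using f g par by (auto simp: x_def y_def)
  note fg = f g x y
  have q: "arr D q" "src q = FObj U y" "tgt q = c" and s: "arr D s" "src s = c" "tgt s = FObj U y"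
    and t: "arr D t" "src t = FObj U y" "tgt t = FObj U x" and c: "c \<in> Obj D"
    and coeq: "q \<cdot>\<^bsub>D\<^esub> (U \<star> f) = q \<cdot>\<^bsub>D\<^esub> (U \<star> g)"
    and qs: "q \<cdot>\<^bsub>D\<^esub> s = ide D c" and ft: "(U \<star> f) \<cdot>\<^bsub>D\<^esub> t = ide D (FObj U y)"
    and gt: "(U \<star> g) \<cdot>\<^bsub>D\<^esub> t = s \<cdot>\<^bsub>D\<^esub> q"
    using split fg by (auto simp: split_coequalizer_def c_def)
  note typing = fg q s t c
  have \<theta>: "arr D (\<theta> b)" "src (\<theta> b) = FObj U (FObj U.L (FObj U b))" "tgt (\<theta> b) = FObj U b"
    if "b \<in> Obj B" for b
    using that by (simp_all add: \<theta>_def)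
  have \<theta>_nat: "\<theta> (tgt h) \<cdot>\<^bsub>D\<^esub> (U \<star> U.L \<star> U \<star> h) = (U \<star> h) \<cdot>\<^bsub>D\<^esub> \<theta> (src h)" if "arr B h" for h
    using that counit_image_nat by (simp add: \<theta>_def)
  have \<theta>\<eta>: "\<theta> b \<cdot>\<^bsub>D\<^esub> U.\<eta> (FObj U b) = ide D (FObj U b)" if "b \<in> Obj B" for b
    using that by (simp add: \<theta>_def)
  define \<gamma> where "\<gamma> = q \<cdot>\<^bsub>D\<^esub> \<theta> y \<cdot>\<^bsub>D\<^esub> (U \<star> U.L \<star> s)"
  have \<gamma>: "arr D \<gamma>" "src \<gamma> = FObj U (FObj U.L c)" "tgt \<gamma> = c"
    using typing \<theta> by (simp_all add: \<gamma>_def)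
  have \<gamma>_str: "U.structure_arr (c, mor \<gamma>) = \<gamma>"
    using \<gamma> by (intro arrow_eqI) (simp_all add: U.structure_arr_def)
  \<comment> \<open>The splitting turns \<open>s \<cdot> q\<close> into \<open>U g \<cdot> t\<close>, and \<open>U g\<close> is a morphism of algebras.\<close>
  have \<gamma>q: "\<gamma> \<cdot>\<^bsub>D\<^esub> (U \<star> U.L \<star> q) = q \<cdot>\<^bsub>D\<^esub> \<theta> y"
  proof -
    have 1: "(U \<star> U.L \<star> s) \<cdot>\<^bsub>D\<^esub> (U \<star> U.L \<star> q) = (U \<star> U.L \<star> U \<star> g) \<cdot>\<^bsub>D\<^esub> (U \<star> U.L \<star> t)"
      using arg_cong[OF gt, of "\<lambda>v. U \<star> U.L \<star> v"] typing by simp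
    have 2: "(U \<star> U.L \<star> U \<star> f) \<cdot>\<^bsub>D\<^esub> (U \<star> U.L \<star> t) = ide D (FObj U (FObj U.L (FObj U y)))"
      using arg_cong[OF ft, of "\<lambda>v. U \<star> U.L \<star> v"] typing by simp
    have "\<gamma> \<cdot>\<^bsub>D\<^esub> (U \<star> U.L \<star> q) = q \<cdot>\<^bsub>D\<^esub> \<theta> y \<cdot>\<^bsub>D\<^esub> (U \<star> U.L \<star> U \<star> g) \<cdot>\<^bsub>D\<^esub> (U \<star> U.L \<star> t)"
      using typing \<theta> by (simp add: \<gamma>_def 1)
    also have "\<dots> = q \<cdot>\<^bsub>D\<^esub> (U \<star> g) \<cdot>\<^bsub>D\<^esub> \<theta> x \<cdot>\<^bsub>D\<^esub> (U \<star> U.L \<star> t)"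
      using typing \<theta> U.right.target.cmp_reassoc[OF \<theta>_nat[OF g]] by simp
    also have "\<dots> = q \<cdot>\<^bsub>D\<^esub> (U \<star> f) \<cdot>\<^bsub>D\<^esub> \<theta> x \<cdot>\<^bsub>D\<^esub> (U \<star> U.L \<star> t)"
      using typing \<theta> U.right.target.cmp_reassoc[OF coeq] by simp
    also have "\<dots> = q \<cdot>\<^bsub>D\<^esub> \<theta> y \<cdot>\<^bsub>D\<^esub> (U \<star> U.L \<star> U \<star> f) \<cdot>\<^bsub>D\<^esub> (U \<star> U.L \<star> t)"
      using typing \<theta> U.right.target.cmp_reassoc[OF \<theta>_nat[OF f]] by simp
    also have "\<dots> = q \<cdot>\<^bsub>D\<^esub> \<theta> y"
      using typing \<theta> by (simp add: 2)
    finally show ?thesis .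
  qed
  have \<gamma>_unit: "\<gamma> \<cdot>\<^bsub>D\<^esub> U.\<eta> c = ide D c"
    using typing \<theta> by (simp add: \<gamma>_def U.unit_nat U.right.target.cmp_reassoc[OF \<theta>\<eta>] qs)
  have Sqs: "(U \<star> U.L \<star> q) \<cdot>\<^bsub>D\<^esub> (U \<star> U.L \<star> s) = ide D (FObj U (FObj U.L c))"
    using arg_cong[OF qs, of "\<lambda>v. U \<star> U.L \<star> v"] typing by simp
  \<comment> \<open>Associativity of \<open>\<gamma>\<close> is inherited from \<open>y\<close> along the split epimorphism \<open>S S q\<close>, \<open>S = U L\<close>.\<close>
  have \<gamma>_assoc: "\<gamma> \<cdot>\<^bsub>D\<^esub> (U \<star> U.\<epsilon> (FObj U.L c)) = \<gamma> \<cdot>\<^bsub>D\<^esub> (U \<star> U.L \<star> \<gamma>)"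
  proof (rule U.right.target.split_epi_cancel[where q = "U \<star> U.L \<star> U \<star> U.L \<star> q" and s = "U \<star> U.L \<star> U \<star> U.L \<star> s"])
    show "(U \<star> U.L \<star> U \<star> U.L \<star> q) \<cdot>\<^bsub>D\<^esub> (U \<star> U.L \<star> U \<star> U.L \<star> s) = ide D (tgt (U \<star> U.L \<star> U \<star> U.L \<star> q))"
      using arg_cong[OF Sqs, of "\<lambda>v. U \<star> U.L \<star> v"] typing by simp
    have "(\<gamma> \<cdot>\<^bsub>D\<^esub> \<theta> (FObj U.L c)) \<cdot>\<^bsub>D\<^esub> (U \<star> U.L \<star> U \<star> U.L \<star> q) =
        \<gamma> \<cdot>\<^bsub>D\<^esub> (U \<star> U.L \<star> q) \<cdot>\<^bsub>D\<^esub> \<theta> (FObj U.L (FObj U y))"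
      using typing \<theta> \<gamma> \<theta>_nat[of "U.L \<star> q"] by simp
    also have "\<dots> = q \<cdot>\<^bsub>D\<^esub> \<theta> y \<cdot>\<^bsub>D\<^esub> \<theta> (FObj U.L (FObj U y))"
      using typing \<theta> \<gamma> U.right.target.cmp_reassoc[OF \<gamma>q] by simp
    also have "\<dots> = q \<cdot>\<^bsub>D\<^esub> \<theta> y \<cdot>\<^bsub>D\<^esub> (U \<star> U.L \<star> \<theta> y)"
      using typing \<theta> \<theta>_nat[of "U.\<epsilon> y"] by (simp add: \<theta>_def)
    also have "\<dots> = (\<gamma> \<cdot>\<^bsub>D\<^esub> (U \<star> U.L \<star> q)) \<cdot>\<^bsub>D\<^esub> (U \<star> U.L \<star> \<theta> y)"
      unfolding \<gamma>q using typing \<theta> by simp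
    also have "\<dots> = \<gamma> \<cdot>\<^bsub>D\<^esub> (U \<star> U.L \<star> (q \<cdot>\<^bsub>D\<^esub> \<theta> y))"
      using typing \<theta> \<gamma> by simp
    also have "\<dots> = (\<gamma> \<cdot>\<^bsub>D\<^esub> (U \<star> U.L \<star> \<gamma>)) \<cdot>\<^bsub>D\<^esub> (U \<star> U.L \<star> U \<star> U.L \<star> q)"
      unfolding \<gamma>q[symmetric] using typing \<theta> \<gamma> by simp
    finally show "(\<gamma> \<cdot>\<^bsub>D\<^esub> (U \<star> U.\<epsilon> (FObj U.L c))) \<cdot>\<^bsub>D\<^esub> (U \<star> U.L \<star> U \<star> U.L \<star> q) =
        (\<gamma> \<cdot>\<^bsub>D\<^esub> (U \<star> U.L \<star> \<gamma>)) \<cdot>\<^bsub>D\<^esub> (U \<star> U.L \<star> U \<star> U.L \<star> q)"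
      by (simp add: \<theta>_def)
  qed (use typing \<gamma> in simp_all)
  have alg: "(c, mor \<gamma>) \<in> Obj ?EM"
    unfolding U.Obj_EM_iff \<gamma>_str using \<gamma>_unit \<gamma>_assoc \<gamma> by simp
  obtain K' where K': "cat_functor ?EM B K'"
    and KK': "\<And>f. arr ?EM f \<Longrightarrow> ?K \<star> K' \<star> f = f"
    and K'K: "\<And>x. x \<in> Obj B \<Longrightarrow> FObj K' (FObj ?K x) = x"
    by (rule comparison_iso_inverse) blast
  interpret K': cat_functor ?EM B K' by (rule K')
  define \<pi> where "\<pi> = Arrow (FObj ?K y) (mor q) (c, mor \<gamma>)"
  have q_tuple: "Arrow (FObj U y) (mor q) c = q"
    using q by (metis arrow.collapse)
  have \<pi>: "arr ?EM \<pi>"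
    unfolding U.arr_EM_iff using typing alg \<gamma>q by (simp add: \<pi>_def \<gamma>_str q_tuple \<theta>_def)
  have U_K': "U \<star> K' \<star> \<pi> = q"
  proof (rule arrow_eqI)
    have K\<pi>: "?K \<star> K' \<star> \<pi> = \<pi>" using KK' \<pi> by simp
    show "mor (U \<star> K' \<star> \<pi>) = mor q"
      using arg_cong[OF K\<pi>, of mor] by (simp add: \<pi>_def)
    show "src (U \<star> K' \<star> \<pi>) = src q"
      using arg_cong[OF K\<pi>, of "\<lambda>v. fst (src v)"] q by (simp add: \<pi>_def)
    show "tgt (U \<star> K' \<star> \<pi>) = tgt q"
      using arg_cong[OF K\<pi>, of "\<lambda>v. fst (tgt v)"] q by (simp add: \<pi>_def)
  qed
  have unique_\<gamma>: "U \<star> U.\<epsilon> (tgt p) = \<gamma>" if p: "arr B p" "src p = y" "U \<star> p = q" for p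
  proof (rule U.right.target.split_epi_cancel[where q = "U \<star> U.L \<star> q" and s = "U \<star> U.L \<star> s"])
    have Up: "FObj U (tgt p) = c" using p q by (metis src_tgt_simps(6))
    show "(U \<star> U.\<epsilon> (tgt p)) \<cdot>\<^bsub>D\<^esub> (U \<star> U.L \<star> q) = \<gamma> \<cdot>\<^bsub>D\<^esub> (U \<star> U.L \<star> q)"
      using \<theta>_nat[OF p(1)] p by (simp add: \<gamma>q \<theta>_def)
  qed (use p typing \<gamma> Sqs in \<open>simp_all, metis src_tgt_simps(6)\<close>)
  show "\<exists>!p. arr B p \<and> src p = tgt f \<and> U \<star> p = q"
  proof (rule ex1I)
    show "arr B (K' \<star> \<pi>) \<and> src (K' \<star> \<pi>) = tgt f \<and> U \<star> K' \<star> \<pi> = q"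
      using \<pi> U_K' K'K y by (simp add: \<pi>_def)
    fix p assume "arr B p \<and> src p = tgt f \<and> U \<star> p = q"
    then have p: "arr B p" "src p = y" "U \<star> p = q" using y by auto
    have K'\<pi>: "arr B (K' \<star> \<pi>)" "src (K' \<star> \<pi>) = y"
      using \<pi> K'K y by (simp_all add: \<pi>_def)
    have "tgt p = tgt (K' \<star> \<pi>)"
      using unique_\<gamma>[OF p] unique_\<gamma>[OF K'\<pi> U_K'] arr_tgt[OF p(1)] arr_tgt[OF K'\<pi>(1)]
      by (intro comparison_iso_eqI) auto
    then show "p = K' \<star> \<pi>"
      using p K'\<pi> U_K' by (intro faithfulD[OF comparison_iso_faithful]) auto
  qed
  show "coequalizes B f g p" if p: "arr B p" "src p = tgt f" "U \<star> p = q"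
  proof -
    have "U \<star> (p \<cdot>\<^bsub>B\<^esub> f) = U \<star> (p \<cdot>\<^bsub>B\<^esub> g)" using p fg coeq by simp
    then show ?thesis
      using p fg comparison_iso_faithful by (auto simp: coequalizes_def intro: faithfulD)
  qed
  assume p: "arr B p" "src p = tgt f" "U \<star> p = q" and h: "coequalizes B f g h"
  define z where "z = tgt p"
  define d where "d = tgt h"
  have h': "arr B h" "src h = y" "tgt h = d" "h \<cdot>\<^bsub>B\<^esub> f = h \<cdot>\<^bsub>B\<^esub> g" and d: "d \<in> Obj B"
    using h y by (auto simp: coequalizes_def d_def)
  have z: "z \<in> Obj B" "FObj U z = c" "\<theta> z = \<gamma>"
    using p q y unique_\<gamma> by (auto simp: z_def \<theta>_def)
  \<comment> \<open>the factorization of \<open>U h\<close> through \<open>q\<close> given by the splitting; it is a morphism of algebras\<close>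
  define u where "u = (U \<star> h) \<cdot>\<^bsub>D\<^esub> s"
  have u: "arr D u" "src u = c" "tgt u = FObj U d"
    using typing h' by (simp_all add: u_def)
  have Uhfg: "(U \<star> h) \<cdot>\<^bsub>D\<^esub> (U \<star> f) = (U \<star> h) \<cdot>\<^bsub>D\<^esub> (U \<star> g)"
    using arg_cong[OF h'(4), of "\<lambda>v. U \<star> v"] h'(1-3) fg by simp
  have uq: "u \<cdot>\<^bsub>D\<^esub> q = U \<star> h"
  proof -
    have "u \<cdot>\<^bsub>D\<^esub> q = (U \<star> h) \<cdot>\<^bsub>D\<^esub> (U \<star> g) \<cdot>\<^bsub>D\<^esub> t"
      using typing h' by (simp add: u_def gt)
    also have "\<dots> = (U \<star> h) \<cdot>\<^bsub>D\<^esub> (U \<star> f) \<cdot>\<^bsub>D\<^esub> t"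
      using typing h' U.right.target.cmp_reassoc[OF Uhfg] by simp
    also have "\<dots> = U \<star> h" using typing h' by (simp add: ft)
    finally show ?thesis .
  qed
  have u\<gamma>: "u \<cdot>\<^bsub>D\<^esub> \<gamma> = \<theta> d \<cdot>\<^bsub>D\<^esub> (U \<star> U.L \<star> u)"
  proof -
    have "u \<cdot>\<^bsub>D\<^esub> \<gamma> = (U \<star> h) \<cdot>\<^bsub>D\<^esub> \<theta> y \<cdot>\<^bsub>D\<^esub> (U \<star> U.L \<star> s)"
      using typing h' \<theta> u U.right.target.cmp_reassoc[OF uq] by (simp add: \<gamma>_def)
    also have "\<dots> = \<theta> d \<cdot>\<^bsub>D\<^esub> (U \<star> U.L \<star> u)"
      using typing h' \<theta> d U.right.target.cmp_reassoc[OF \<theta>_nat[OF h'(1)]] by (simp add: u_def)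
    finally show ?thesis .
  qed
  define \<nu> where "\<nu> = Arrow (FObj ?K z) (mor u) (FObj ?K d)"
  have u_tuple: "Arrow c (mor u) (FObj U d) = u" using u by (metis arrow.collapse)
  have \<nu>: "arr ?EM \<nu>"
    unfolding U.arr_EM_iff using z d u u\<gamma> by (simp add: \<nu>_def u_tuple \<theta>_def)
  have K'\<nu>: "arr B (K' \<star> \<nu>)" "src (K' \<star> \<nu>) = z" "tgt (K' \<star> \<nu>) = d"
    using \<nu> z d K'K by (simp_all add: \<nu>_def)
  have "U \<star> K' \<star> \<nu> = u"
  proof (rule arrow_eqI)
    show "mor (U \<star> K' \<star> \<nu>) = mor u"
      using arg_cong[OF KK'[OF \<nu>], of mor] by (simp add: \<nu>_def)
  qed (use K'\<nu> z u in simp_all)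
  then have "U \<star> ((K' \<star> \<nu>) \<cdot>\<^bsub>B\<^esub> p) = U \<star> h"
    using K'\<nu> p z_def uq by simp
  then have "(K' \<star> \<nu>) \<cdot>\<^bsub>B\<^esub> p = h"
    using K'\<nu> p h' y by (intro faithfulD[OF comparison_iso_faithful]) (auto simp: z_def)
  then show "\<exists>u. arr B u \<and> src u = tgt p \<and> tgt u = tgt h \<and> u \<cdot>\<^bsub>B\<^esub> p = h"
    using K'\<nu> h' z_def by metis
qed

end

lemma strictly_monadic_beck:
  assumes "strictly_monadic B D U"
  shows "cat_functor B D U" "faithful B U" "creates_split_coequalizers B D U"
proof -
  obtain J where J: "adjunction B D U J" "cat_isomorphism B (EM D (induced_monad U J)) (comparison U J)"
    using assms by (auto simp: strictly_monadic_def)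
  show "cat_functor B D U" using J(1) by (simp add: adjunction_def)
  show "faithful B U" by (rule comparison_iso_faithful[OF J])
  show "creates_split_coequalizers B D U"
    unfolding creates_split_coequalizers_def
    by (intro allI impI conjI) (erule (4) comparison_iso_creates[OF J]; assumption)+
qed

lemma (in cat_functor) split_coequalizer_amap:
  assumes "split_coequalizer C f g q s t" "arr C f" "arr C g" "src f = src g" "tgt f = tgt g"
  shows "split_coequalizer D (F \<star> f) (F \<star> g) (F \<star> q) (F \<star> s) (F \<star> t)"
proof -
  have *: "arr C q" "arr C s" "arr C t" "src q = tgt f" "src s = tgt q" "tgt s = src q"
    "src t = tgt f" "tgt t = src f" "q \<cdot>\<^bsub>C\<^esub> f = q \<cdot>\<^bsub>C\<^esub> g"
    "q \<cdot>\<^bsub>C\<^esub> s = ide C (tgt q)" "f \<cdot>\<^bsub>C\<^esub> t = ide C (tgt f)" "g \<cdot>\<^bsub>C\<^esub> t = s \<cdot>\<^bsub>C\<^esub> q"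
    using assms(1) by (simp_all add: split_coequalizer_def)
  have "F \<star> (q \<cdot>\<^bsub>C\<^esub> f) = F \<star> (q \<cdot>\<^bsub>C\<^esub> g)" "F \<star> (q \<cdot>\<^bsub>C\<^esub> s) = ide D (FObj F (tgt q))"
    "F \<star> (f \<cdot>\<^bsub>C\<^esub> t) = ide D (FObj F (tgt f))" "F \<star> (g \<cdot>\<^bsub>C\<^esub> t) = F \<star> (s \<cdot>\<^bsub>C\<^esub> q)"
    unfolding *(9-12) using *(1) assms(2) by simp_all
  then show ?thesis
    using *(1-8) assms(2-5) by (simp add: split_coequalizer_def)
qed

section \<open>One step of the tower\<close>

text \<open>
  An adjunction together with an adjunction for its comparison functor. The Eilenberg--Moore category
  has its objects tagged by \<open>Alg\<close> as in the tower, so that one type serves for both categories.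
\<close>

locale comparison_step =
  base: adjunction X A G J +
  step: adjunction X "rename_cat Alg unAlg (EM A (induced_monad G J))"
    "rename_func Alg \<circ>\<^sub>F comparison G J" J'
  for X :: "('x, 'y) cat" and A :: "(('o, 'm) tower_obj, 'm) cat"
    and G :: "('x, 'y, ('o, 'm) tower_obj, 'm) func"
    and J :: "(('o, 'm) tower_obj, 'm, 'x, 'y) adj_data"
    and J' :: "(('o, 'm) tower_obj, 'm, 'x, 'y) adj_data"
begin

abbreviation A' :: "(('o, 'm) tower_obj, 'm) cat" where
  "A' \<equiv> rename_cat Alg unAlg (EM A (induced_monad G J))"
abbreviation G' :: "('x, 'y, ('o, 'm) tower_obj, 'm) func" where
  "G' \<equiv> rename_func Alg \<circ>\<^sub>F comparison G J"
abbreviation V :: "(('o, 'm) tower_obj, 'm, ('o, 'm) tower_obj, 'm) func" where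
  "V \<equiv> tower_forget"

definition \<alpha> :: "('o, 'm) tower_obj \<Rightarrow> (('o, 'm) tower_obj, 'm) arrow" where
  "\<alpha> c = base.structure_arr (unAlg c)"

lemma FObj_forget: "FObj V c = fst (unAlg c)"
  by (simp add: tower_forget_def EM_forget_def rename_func_def FObj_comp_func)

lemma mor_forget [simp]: "mor (V \<star> f) = mor f"
  by (simp add: tower_forget_def EM_forget_def rename_func_def amap_def comp_func_def)

lemma src_tgt_\<alpha> [simp]: "src (\<alpha> c) = FObj G (FObj base.L (FObj V c))" "tgt (\<alpha> c) = FObj V c"
  by (simp_all add: \<alpha>_def FObj_forget)

lemma Obj_step_iff:
  "c \<in> Obj A' \<longleftrightarrow> (\<exists>p. c = Alg p) \<and> arr A (\<alpha> c) \<and> \<alpha> c \<cdot>\<^bsub>A\<^esub> base.\<eta> (FObj V c) = ide A (FObj V c) \<and>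
     \<alpha> c \<cdot>\<^bsub>A\<^esub> (G \<star> base.\<epsilon> (FObj base.L (FObj V c))) = \<alpha> c \<cdot>\<^bsub>A\<^esub> (G \<star> base.L \<star> \<alpha> c)"
  by (auto simp: rename_cat_def \<alpha>_def FObj_forget base.Obj_EM_iff)

lemma
  assumes "c \<in> Obj A'"
  shows arr_\<alpha> [simp]: "arr A (\<alpha> c)"
    and \<alpha>_unit [simp]: "\<alpha> c \<cdot>\<^bsub>A\<^esub> base.\<eta> (FObj V c) = ide A (FObj V c)"
    and \<alpha>_assoc: "\<alpha> c \<cdot>\<^bsub>A\<^esub> (G \<star> base.\<epsilon> (FObj base.L (FObj V c))) = \<alpha> c \<cdot>\<^bsub>A\<^esub> (G \<star> base.L \<star> \<alpha> c)"
    and Obj_forget [simp]: "FObj V c \<in> Obj A"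
  using assms Obj_step_iff[of c] arr_tgt[of A "\<alpha> c"] by auto

lemma \<alpha>_inject: "c \<in> Obj A' \<Longrightarrow> c' \<in> Obj A' \<Longrightarrow> \<alpha> c = \<alpha> c' \<Longrightarrow> c = c'"
  using base.structure_arr_inject by (auto simp: \<alpha>_def Obj_step_iff)

lemma forget_tuple: "V \<star> f = Arrow (fst (unAlg (src f))) (mor f) (fst (unAlg (tgt f)))"
  by (rule arrow_eqI) (simp_all add: FObj_forget)

lemma arr_step_iff:
  "arr A' f \<longleftrightarrow> src f \<in> Obj A' \<and> tgt f \<in> Obj A' \<and> arr A (V \<star> f) \<and>
     (V \<star> f) \<cdot>\<^bsub>A\<^esub> \<alpha> (src f) = \<alpha> (tgt f) \<cdot>\<^bsub>A\<^esub> (G \<star> base.L \<star> V \<star> f)"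
proof -
  have *: "arr A' f \<longleftrightarrow> src f \<in> Obj A' \<and> tgt f \<in> Obj A' \<and>
      arr (EM A (induced_monad G J)) (Arrow (unAlg (src f)) (mor f) (unAlg (tgt f)))"
    by (auto simp: arr_def rename_cat_def simp del: arr_src arr_tgt)
  show ?thesis
    unfolding * base.arr_EM_iff
    by (auto simp: \<alpha>_def forget_tuple rename_cat_def)
qed

lemma mor_ide_step: "mor (ide A' c) = mor (ide A (FObj V c))"
  by (simp add: ide_def rename_cat_def EM_def FObj_forget case_prod_beta)

lemma mor_cmp_step: "mor (g \<cdot>\<^bsub>A'\<^esub> f) = Comp A (mor g) (mor f)"
  by (simp add: cmp_def rename_cat_def EM_def)

lemma forget_functor: "cat_functor A' A V"
proof (rule cat_functor_arrI)
  show "V \<star> ide A' a = ide A (FObj V a)" for a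
    by (rule arrow_eqI) (simp_all add: mor_ide_step)
  show "V \<star> (g \<cdot>\<^bsub>A'\<^esub> f) = (V \<star> g) \<cdot>\<^bsub>A\<^esub> (V \<star> f)" for f g
    by (rule arrow_eqI) (simp_all add: mor_cmp_step, simp add: cmp_def)
  show "arr A (V \<star> f)" if "arr A' f" for f
    using that arr_step_iff[of f] by blast
  show "category A'" "category A" by unfold_locales
qed simp

sublocale V: cat_functor A' A V
  by (rule forget_functor)

lemma arr_step_nat: "arr A' f \<Longrightarrow> (V \<star> f) \<cdot>\<^bsub>A\<^esub> \<alpha> (src f) = \<alpha> (tgt f) \<cdot>\<^bsub>A\<^esub> (G \<star> base.L \<star> V \<star> f)"
  using arr_step_iff[of f] by blast

lemma forget_eqI: "src f = src g \<Longrightarrow> tgt f = tgt g \<Longrightarrow> V \<star> f = V \<star> g \<Longrightarrow> f = g"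
  by (intro arrow_eqI) (assumption, metis mor_forget, assumption)

lemma forget_Arrow [simp]:
  "src f = FObj V c \<Longrightarrow> tgt f = FObj V c' \<Longrightarrow> V \<star> Arrow c (mor f) c' = f"
  by (rule arrow_eqI) simp_all

lemma forget_comparison [simp]: "V \<star> G' \<star> f = G \<star> f" "FObj V (FObj G' x) = FObj G x"
  and \<alpha>_comparison [simp]: "\<alpha> (FObj G' x) = G \<star> base.\<epsilon> x"
proof -
  show obj: "FObj V (FObj G' x) = FObj G x" for x
    by (simp add: FObj_forget rename_func_def FObj_comp_func)
  show "V \<star> G' \<star> f = G \<star> f"
    by (rule arrow_eqI) (simp_all add: obj, simp add: amap_def comparison_def rename_func_def comp_func_def)
  show "\<alpha> (FObj G' x) = G \<star> base.\<epsilon> x"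
    by (simp add: \<alpha>_def rename_func_def FObj_comp_func)
qed

lemma invertible_if_forget_invertible:
  assumes f: "arr A' f" and "invertible A (V \<star> f)"
  shows "invertible A' f"
proof -
  obtain g where g: "arr A g" "src g = FObj V (tgt f)" "tgt g = FObj V (src f)"
    "g \<cdot>\<^bsub>A\<^esub> (V \<star> f) = ide A (FObj V (src f))" "(V \<star> f) \<cdot>\<^bsub>A\<^esub> g = ide A (FObj V (tgt f))"
    using assms(2) by (auto simp: invertible_def inverse_arrows_def)
  define g' where "g' = Arrow (tgt f) (mor g) (src f)"
  have Vg': "V \<star> g' = g" "src g' = tgt f" "tgt g' = src f" using g by (simp_all add: g'_def)
  have Tg: "(G \<star> base.L \<star> V \<star> f) \<cdot>\<^bsub>A\<^esub> (G \<star> base.L \<star> g) = ide A (FObj G (FObj base.L (FObj V (tgt f))))"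
    using arg_cong[OF g(5), of "\<lambda>v. G \<star> base.L \<star> v"] g(1-3) f by simp
  have "g \<cdot>\<^bsub>A\<^esub> \<alpha> (tgt f) = g \<cdot>\<^bsub>A\<^esub> \<alpha> (tgt f) \<cdot>\<^bsub>A\<^esub> (G \<star> base.L \<star> V \<star> f) \<cdot>\<^bsub>A\<^esub> (G \<star> base.L \<star> g)"
    unfolding Tg using g f by simp
  also have "\<dots> = g \<cdot>\<^bsub>A\<^esub> (V \<star> f) \<cdot>\<^bsub>A\<^esub> \<alpha> (src f) \<cdot>\<^bsub>A\<^esub> (G \<star> base.L \<star> g)"
    using base.right.target.cmp_reassoc[OF arr_step_nat[OF f, symmetric]] g(1-3) f by simp
  also have "\<dots> = \<alpha> (src f) \<cdot>\<^bsub>A\<^esub> (G \<star> base.L \<star> g)"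
    using base.right.target.cmp_reassoc[OF g(4)] g(1-3) f by simp
  finally have g': "arr A' g'"
    unfolding arr_step_iff[of g'] using f g by (simp add: Vg')
  have "g' \<cdot>\<^bsub>A'\<^esub> f = ide A' (src f)" "f \<cdot>\<^bsub>A'\<^esub> g' = ide A' (tgt f)"
    by (rule forget_eqI, use f g g' in \<open>simp_all add: Vg'\<close>)+
  then have "inverse_arrows A' f g'"
    using f g' by (simp add: inverse_arrows_def Vg')
  then show ?thesis unfolding invertible_def by blast
qed

end

section \<open>Lifting functors to the algebras\<close>

context comparison_step
begin

text \<open>
  Every algebra is the quotient of the free algebra on its underlying object, and in the underlying
  category this quotient is split by the unit.
\<close>

lemma split_presentation:
  assumes "c \<in> Obj A'"
  shows "split_coequalizer A (G \<star> base.\<epsilon> (FObj base.L (FObj V c))) (G \<star> base.L \<star> \<alpha> c)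
    (\<alpha> c) (base.\<eta> (FObj V c)) (base.\<eta> (FObj G (FObj base.L (FObj V c))))"
  using assms \<alpha>_assoc[OF assms] by (simp add: split_coequalizer_def base.unit_nat)

text \<open>
  The structure map again, now as a morphism of algebras from the free algebra on the underlying
  object.
\<close>

definition free_action :: "('o, 'm) tower_obj \<Rightarrow> (('o, 'm) tower_obj, 'm) arrow" where
  "free_action c = Arrow (FObj G' (FObj base.L (FObj V c))) (mor (\<alpha> c)) c"

lemma src_tgt_free_action [simp]:
  "src (free_action c) = FObj G' (FObj base.L (FObj V c))" "tgt (free_action c) = c"
  by (simp_all add: free_action_def)

lemma forget_free_action [simp]: "V \<star> free_action c = \<alpha> c"
  by (simp add: free_action_def)

lemma arr_free_action [simp]: "c \<in> Obj A' \<Longrightarrow> arr A' (free_action c)"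
  unfolding arr_step_iff[of "free_action c"] using \<alpha>_assoc[of c] by simp

text \<open>
  A functor \<open>N\<close> on the base of the tower step lifts through \<open>U\<close> as soon as it does so on the image
  of \<open>G\<close>: free algebras lie in the image of the comparison functor, where the lift has to be \<open>H\<close>, and
  a general algebra is sent to the coequalizer created over its canonical presentation.
\<close>

theorem lift_to_step:
  assumes N: "cat_functor A D N" "faithful A N" "conservative A D N"
    and U: "cat_functor B D U" "faithful B U" "creates_split_coequalizers B D U"
    and H: "cat_functor X B H" and NG: "\<And>f. arr X f \<Longrightarrow> N \<star> G \<star> f = U \<star> H \<star> f"
  obtains N' where "cat_functor A' B N'" "faithful A' N'" "conservative A' B N'"
    "\<And>f. arr X f \<Longrightarrow> N' \<star> G' \<star> f = H \<star> f" "\<And>f. arr A' f \<Longrightarrow> U \<star> N' \<star> f = N \<star> V \<star> f"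
proof -
  interpret N: cat_functor A D N by (rule N)
  interpret U: cat_functor B D U by (rule U)
  interpret H: cat_functor X B H by (rule H)
  have NG_obj: "FObj N (FObj G x) = FObj U (FObj H x)" if "x \<in> Obj X" for x
    using arg_cong[OF NG[of "ide X x"], of src] that by simp
  define F where "F = (\<lambda>c. FObj base.L (FObj V c))"
  have F: "F c \<in> Obj X" if "c \<in> Obj A'" for c using that by (simp add: F_def)
  have F_fold: "FObj base.L (FObj V c) = F c" for c by (simp add: F_def)
  define e where "e = (\<lambda>c. H \<star> base.\<epsilon> (F c))"
  define m where "m = (\<lambda>c. H \<star> base.L \<star> \<alpha> c)"
  define is_p where "is_p = (\<lambda>c p. arr B p \<and> src p = FObj H (F c) \<and> U \<star> p = N \<star> \<alpha> c)"
  have em: "arr B (e c)" "arr B (m c)" "src (e c) = src (m c)"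
    "tgt (e c) = FObj H (F c)" "tgt (m c) = FObj H (F c)" if "c \<in> Obj A'" for c
    using that F by (simp_all add: e_def m_def F_def)
  have em_tgt: "tgt (e c) = tgt (m c)" if "c \<in> Obj A'" for c
    using em[OF that] by simp
  have split: "split_coequalizer D (U \<star> e c) (U \<star> m c) (N \<star> \<alpha> c) (N \<star> base.\<eta> (FObj V c))
      (N \<star> base.\<eta> (FObj G (F c)))" if c: "c \<in> Obj A'" for c
    using N.split_coequalizer_amap[OF split_presentation[OF c]] c
    by (simp add: e_def m_def F_def NG)
  have ex1_p: "\<exists>!p. is_p c p" if "c \<in> Obj A'" for c
    using U(3) em[OF that] split[OF that] unfolding creates_split_coequalizers_def is_p_def
    by metis
  \<comment> \<open>the quotient map onto the value at \<open>c\<close> of the lifted functor\<close>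
  define p where "p = (\<lambda>c. THE p. is_p c p)"
  have p: "is_p c (p c)" if "c \<in> Obj A'" for c
    using theI'[OF ex1_p[OF that]] by (simp add: p_def)
  then have p: "arr B (p c)" "src (p c) = FObj H (F c)" "U \<star> p c = N \<star> \<alpha> c" if "c \<in> Obj A'" for c
    using that by (simp_all add: is_p_def)
  have p_univ: "\<And>h. coequalizes B (e c) (m c) h \<Longrightarrow>
      \<exists>u. arr B u \<and> src u = tgt (p c) \<and> tgt u = tgt h \<and> u \<cdot>\<^bsub>B\<^esub> p c = h" if c: "c \<in> Obj A'" for c
  proof -
    show "\<exists>u. arr B u \<and> src u = tgt (p c) \<and> tgt u = tgt h \<and> u \<cdot>\<^bsub>B\<^esub> p c = h"
      if h: "coequalizes B (e c) (m c) h" for h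
    proof -
      have "coequalizes B (e c) (m c) (p c) \<and> (\<forall>h. coequalizes B (e c) (m c) h \<longrightarrow>
        (\<exists>u. arr B u \<and> src u = tgt (p c) \<and> tgt u = tgt h \<and> u \<cdot>\<^bsub>B\<^esub> p c = h))"
      by (rule U(3)[unfolded creates_split_coequalizers_def, rule_format,
            OF em(1-3)[OF c] em_tgt[OF c] split[OF c], THEN conjunct2, rule_format, OF p(1)[OF c] _ p(3)[OF c]])
        (simp_all add: p c em)
      then show ?thesis using h by blast
    qed
  qed
  define n where "n = (\<lambda>c. tgt (p c))"
  have n: "n c \<in> Obj B" "FObj U (n c) = FObj N (FObj V c)" if "c \<in> Obj A'" for c
    using arr_tgt[OF p(1)[OF that]] arg_cong[OF p(3)[OF that], of tgt] by (simp_all add: n_def)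
  define is_n where "is_n = (\<lambda>f u. arr B u \<and> src u = n (src f) \<and> tgt u = n (tgt f) \<and> U \<star> u = N \<star> V \<star> f)"
  have "\<exists>u. is_n f u" if f: "arr A' f" for f
  proof -
    let ?a = "src f" and ?b = "tgt f"
    have c: "?a \<in> Obj A'" "?b \<in> Obj A'" using f by simp_all
    \<comment> \<open>the lift of \<open>f\<close> is induced by its action on the free algebras\<close>
    define h where "h = p ?b \<cdot>\<^bsub>B\<^esub> (H \<star> base.L \<star> V \<star> f)"
    have h: "arr B h" "src h = FObj H (F ?a)" "tgt h = n ?b"
      using c p[of ?b] f by (simp_all add: h_def F_def n_def)
    have Uh: "U \<star> h = (N \<star> V \<star> f) \<cdot>\<^bsub>D\<^esub> (N \<star> \<alpha> ?a)"
      using arg_cong[OF arr_step_nat[OF f], of "\<lambda>v. N \<star> v"] c p[of ?b] f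
      by (simp add: h_def F_def NG[symmetric])
    have "U \<star> (h \<cdot>\<^bsub>B\<^esub> e ?a) = U \<star> (h \<cdot>\<^bsub>B\<^esub> m ?a)"
    proof -
      have "(N \<star> \<alpha> ?a) \<cdot>\<^bsub>D\<^esub> (U \<star> e ?a) = (N \<star> \<alpha> ?a) \<cdot>\<^bsub>D\<^esub> (U \<star> m ?a)"
        using split[OF c(1)] by (simp add: split_coequalizer_def)
      then show ?thesis
        using h em[OF c(1)] c f by (simp add: Uh NG_obj F F_fold)
    qed
    then have "coequalizes B (e ?a) (m ?a) h"
      using h em[OF c(1)] by (auto simp: coequalizes_def intro: faithfulD[OF U(2)])
    then obtain u where u: "arr B u" "src u = n ?a" "tgt u = n ?b" "u \<cdot>\<^bsub>B\<^esub> p ?a = h"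
      using p_univ[OF c(1)] h by (metis n_def)
    have "U \<star> u = N \<star> V \<star> f"
    proof (rule N.target.split_epi_cancel)
      show "(N \<star> \<alpha> ?a) \<cdot>\<^bsub>D\<^esub> (N \<star> base.\<eta> (FObj V ?a)) = ide D (tgt (N \<star> \<alpha> ?a))"
        using split[OF c(1)] by (simp add: split_coequalizer_def)
      have "U \<star> (u \<cdot>\<^bsub>B\<^esub> p ?a) = (U \<star> u) \<cdot>\<^bsub>D\<^esub> (N \<star> \<alpha> ?a)"
        using u(1,2) p[OF c(1)] by (simp add: n_def)
      then show "(U \<star> u) \<cdot>\<^bsub>D\<^esub> (N \<star> \<alpha> ?a) = (N \<star> V \<star> f) \<cdot>\<^bsub>D\<^esub> (N \<star> \<alpha> ?a)"
        by (simp add: u(4) Uh)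
    qed (use c f u n in simp_all)
    then show ?thesis using u by (auto simp: is_n_def)
  qed
  define k where "k = (\<lambda>f. SOME u. is_n f u)"
  have k: "arr B (k f)" "src (k f) = n (src f)" "tgt (k f) = n (tgt f)" "U \<star> k f = N \<star> V \<star> f"
    if "arr A' f" for f
    using someI_ex[OF \<open>arr A' f \<Longrightarrow> \<exists>u. is_n f u\<close>[OF that]] by (simp_all add: is_n_def k_def)
  define N' where "N' = \<lparr>FObj = n, FHom = \<lambda>a b f. mor (k (Arrow a f b))\<rparr>"
  have N'_obj: "FObj N' c = n c" for c by (simp add: N'_def)
  have N'_arr: "N' \<star> f = k f" if "arr A' f" for f
    using k[OF that] by (intro arrow_eqI) (simp_all add: N'_obj, simp add: N'_def amap_def)
  have N'_functor: "cat_functor A' B N'"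
  proof (rule cat_functor_arrI)
    show "category A'" "category B" by unfold_locales
    show "FObj N' a \<in> Obj B" if "a \<in> Obj A'" for a using that n by (simp add: N'_obj)
    show "arr B (N' \<star> f)" if "arr A' f" for f using that k by (simp add: N'_arr)
    show "N' \<star> ide A' a = ide B (FObj N' a)" if "a \<in> Obj A'" for a
      using that k[of "ide A' a"] n
      by (intro faithfulD[OF U(2)]) (simp_all add: N'_arr N'_obj)
    show "N' \<star> (g \<cdot>\<^bsub>A'\<^esub> f) = (N' \<star> g) \<cdot>\<^bsub>B\<^esub> (N' \<star> f)"
      if "arr A' f" "arr A' g" "tgt f = src g" for f g
      using that k[of "g \<cdot>\<^bsub>A'\<^esub> f"] k[of f] k[of g]
      by (intro faithfulD[OF U(2)]) (simp_all add: N'_arr N'_obj)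
  qed
  have UN': "U \<star> N' \<star> f = N \<star> V \<star> f" if "arr A' f" for f
    using that k by (simp add: N'_arr)
  interpret N': cat_functor A' B N' by (rule N'_functor)
  have faithful: "faithful A' N'"
    unfolding faithful_def
  proof (intro allI impI)
    fix f g assume fg: "arr A' f" "arr A' g" "src f = src g" "tgt f = tgt g" "N' \<star> f = N' \<star> g"
    then have "N \<star> V \<star> f = N \<star> V \<star> g" using UN' by metis
    then have "V \<star> f = V \<star> g" using fg by (intro faithfulD[OF N(2)]) simp_all
    then show "f = g" by (rule forget_eqI[OF fg(3,4)])
  qed
  have conservative: "conservative A' B N'"
    unfolding conservative_def
  proof (intro allI impI)
    fix f assume f: "arr A' f" and "invertible B (N' \<star> f)"
    then have "invertible D (N \<star> V \<star> f)" using UN' U.invertible_amap by metis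
    then have "invertible A (V \<star> f)" using N(3) f by (simp add: conservative_def)
    then show "invertible A' f" using invertible_if_forget_invertible f by simp
  qed
  have N'G': "N' \<star> G' \<star> f = H \<star> f" if "arr X f" for f
  proof -
    have obj: "FObj N' (FObj G' x) = FObj H x" if x: "x \<in> Obj X" for x
    proof -
      \<comment> \<open>\<open>H \<epsilon>\<close> lies over the structure map of \<open>G' x\<close>, so it is the created coequalizer.\<close>
      have "is_p (FObj G' x) (H \<star> base.\<epsilon> x)"
        using x by (simp add: is_p_def F_def NG)
      moreover have "is_p (FObj G' x) (p (FObj G' x))"
        using p[of "FObj G' x"] x by (simp add: is_p_def)
      ultimately have "p (FObj G' x) = H \<star> base.\<epsilon> x"
        using ex1_p[of "FObj G' x"] x by auto
      then show ?thesis by (simp add: N'_obj n_def)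
    qed
    show ?thesis
      using that obj UN'[of "G' \<star> f"] by (intro faithfulD[OF U(2)]) (simp_all add: NG)
  qed
  show thesis by (rule that[OF N'_functor faithful conservative N'G' UN'])
qed

end

section \<open>Coreflections\<close>

locale coreflective = adjunction X A G J
  for X :: "('x, 'y) cat" and A :: "('o, 'm) cat"
    and G :: "('x, 'y, 'o, 'm) func" and J :: "('o, 'm, 'x, 'y) adj_data" +
  assumes ff: "fully_faithful A X (LAdj J)"
begin

text \<open>
  The inverse of the unit is the morphism that the fully faithful left adjoint sends to the counit.
\<close>

lemma unit_iso:
  assumes a: "a \<in> Obj A"
  obtains v where "arr A v" "src v = FObj G (FObj L a)" "tgt v = a"
    "v \<cdot>\<^bsub>A\<^esub> \<eta> a = ide A a" "\<eta> a \<cdot>\<^bsub>A\<^esub> v = ide A (FObj G (FObj L a))"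
proof -
  let ?b = "FObj G (FObj L a)"
  have b: "?b \<in> Obj A" using a by simp
  have full: "bij_betw (FHom L c d) (Hom A c d) (Hom X (FObj L c) (FObj L d))"
    if "c \<in> Obj A" "d \<in> Obj A" for c d
    using ff that by (simp add: fully_faithful_def)
  have "mor (\<epsilon> (FObj L a)) \<in> Hom X (FObj L ?b) (FObj L a)"
    using arr_counit[of "FObj L a"] a by (simp add: arr_def del: arr_src arr_tgt)
  then obtain m where m: "m \<in> Hom A ?b a" "FHom L ?b a m = mor (\<epsilon> (FObj L a))"
    using full[OF b a] by (force simp: bij_betw_def)
  define v where "v = Arrow ?b m a"
  have v: "arr A v" "src v = ?b" "tgt v = a"
    using m a b by (simp_all add: v_def arr_def del: arr_src arr_tgt)
  have Lv: "L \<star> v = \<epsilon> (FObj L a)"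
    by (rule arrow_eqI) (simp_all add: v, simp add: amap_def v_def m)
  have "L \<star> (v \<cdot>\<^bsub>A\<^esub> \<eta> a) = L \<star> ide A a"
    using v a by (simp add: Lv)
  then have "FHom L a a (mor (v \<cdot>\<^bsub>A\<^esub> \<eta> a)) = FHom L a a (mor (ide A a))"
    using v by (simp add: amap_def)
  moreover have "mor (v \<cdot>\<^bsub>A\<^esub> \<eta> a) \<in> Hom A a a" "mor (ide A a) \<in> Hom A a a"
    using right.target.arr_cmp[of "\<eta> a" v] right.target.arr_ide[OF a] v a arr_unit[OF a]
    by (simp_all add: arr_def del: arr_src arr_tgt right.target.arr_cmp right.target.arr_ide)
  ultimately have "mor (v \<cdot>\<^bsub>A\<^esub> \<eta> a) = mor (ide A a)"
    using full[OF a a] by (auto simp: bij_betw_def dest: inj_onD)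
  then have "v \<cdot>\<^bsub>A\<^esub> \<eta> a = ide A a"
    using v by (intro arrow_eqI) simp_all
  moreover have "\<eta> a \<cdot>\<^bsub>A\<^esub> v = ide A ?b"
    using unit_nat[of v] v a by (simp add: Lv)
  ultimately show thesis using that v by blast
qed

text \<open>
  The right adjoint inverts the counit, so it sends every section of the counit to the unit; and maps
  out of a value of the left adjoint are determined by their transposes. Hence a section is already
  an inverse.
\<close>

lemma section_of_counit:
  assumes x: "x \<in> Obj X" and s: "arr X s" "src s = x" "tgt s = FObj L (FObj G x)"
    and "\<epsilon> x \<cdot>\<^bsub>X\<^esub> s = ide X x"
  shows "G \<star> s = \<eta> (FObj G x)" and "s \<cdot>\<^bsub>X\<^esub> \<epsilon> x = ide X (FObj L (FObj G x))"
proof -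
  obtain v where v: "arr A v" "src v = FObj G (FObj L (FObj G x))" "tgt v = FObj G x"
    "v \<cdot>\<^bsub>A\<^esub> \<eta> (FObj G x) = ide A (FObj G x)"
    "\<eta> (FObj G x) \<cdot>\<^bsub>A\<^esub> v = ide A (FObj G (FObj L (FObj G x)))"
    using unit_iso[of "FObj G x"] x by auto
  have "G \<star> \<epsilon> x = (G \<star> \<epsilon> x) \<cdot>\<^bsub>A\<^esub> \<eta> (FObj G x) \<cdot>\<^bsub>A\<^esub> v"
    unfolding v(5) using x by simp
  also have "\<dots> = v" using x v(1-3) by simp
  finally have G\<epsilon>: "G \<star> \<epsilon> x = v" .
  have "(G \<star> \<epsilon> x) \<cdot>\<^bsub>A\<^esub> (G \<star> s) = ide A (FObj G x)"
    using arg_cong[OF assms(5), of "\<lambda>f. G \<star> f"] x s by simp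
  then have "\<eta> (FObj G x) \<cdot>\<^bsub>A\<^esub> v \<cdot>\<^bsub>A\<^esub> (G \<star> s) = \<eta> (FObj G x)"
    using x by (simp add: G\<epsilon>)
  then show Gs: "G \<star> s = \<eta> (FObj G x)"
    using right.target.cmp_reassoc[OF v(5), of "G \<star> s"] v x s by simp
  show "s \<cdot>\<^bsub>X\<^esub> \<epsilon> x = ide X (FObj L (FObj G x))"
    by (rule eq_if_transpose_eq[of "FObj G x"]) (use x s Gs in simp_all)
qed

definition counit_inverse :: "'x \<Rightarrow> ('x, 'y) arrow \<Rightarrow> bool" where
  "counit_inverse x s \<longleftrightarrow> arr X s \<and> src s = x \<and> tgt s = FObj L (FObj G x) \<and>
     \<epsilon> x \<cdot>\<^bsub>X\<^esub> s = ide X x \<and> s \<cdot>\<^bsub>X\<^esub> \<epsilon> x = ide X (FObj L (FObj G x)) \<and> G \<star> s = \<eta> (FObj G x)"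

lemma counit_inverseI:
  assumes "x \<in> Obj X" "arr X s" "src s = x" "tgt s = FObj L (FObj G x)" "\<epsilon> x \<cdot>\<^bsub>X\<^esub> s = ide X x"
  shows "counit_inverse x s"
  using assms section_of_counit[OF assms] by (simp add: counit_inverse_def)

text \<open>
  The counit is natural, and hence so is its inverse, wherever it exists.
\<close>

lemma counit_inverse_nat:
  assumes f: "arr X f" and s: "counit_inverse (src f) s" and t: "counit_inverse (tgt f) t"
  shows "t \<cdot>\<^bsub>X\<^esub> f = (L \<star> G \<star> f) \<cdot>\<^bsub>X\<^esub> s"
proof -
  have s: "arr X s" "src s = src f" "tgt s = FObj L (FObj G (src f))"
      "\<epsilon> (src f) \<cdot>\<^bsub>X\<^esub> s = ide X (src f)"
    and t: "arr X t" "src t = tgt f" "tgt t = FObj L (FObj G (tgt f))"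
      "t \<cdot>\<^bsub>X\<^esub> \<epsilon> (tgt f) = ide X (FObj L (FObj G (tgt f)))"
    using s t by (simp_all add: counit_inverse_def)
  have "t \<cdot>\<^bsub>X\<^esub> f = t \<cdot>\<^bsub>X\<^esub> (f \<cdot>\<^bsub>X\<^esub> \<epsilon> (src f)) \<cdot>\<^bsub>X\<^esub> s"
    using f s t by simp
  also have "\<dots> = t \<cdot>\<^bsub>X\<^esub> \<epsilon> (tgt f) \<cdot>\<^bsub>X\<^esub> (L \<star> G \<star> f) \<cdot>\<^bsub>X\<^esub> s"
    unfolding counit_nat[OF f refl, symmetric] using f s t by simp
  also have "\<dots> = (L \<star> G \<star> f) \<cdot>\<^bsub>X\<^esub> s"
    using right.source.cmp_reassoc[OF t(4)] f s t by simp
  finally show ?thesis .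
qed

end

context
  fixes X :: "('x, 'y) cat" and B :: "('p, 'q) cat" and R JR
  assumes refl: "coreflective X B R JR"
begin

interpretation R: coreflective X B R JR by (rule refl)

text \<open>
  If \<open>G\<close> factors through \<open>R\<close>, then its left adjoint \<open>F\<close> takes values in the coreflective
  subcategory. A section \<open>F a \<rightarrow> L R F a\<close> of the counit of the coreflection is the transpose of the
  unit of \<open>F \<stileturn> G\<close> followed by the image of the unit of \<open>L \<stileturn> R\<close>.
\<close>

lemma counit_iso_at_left_adjoint:
  assumes "adjunction X A G J" and "cat_functor B A W"
    and G: "\<And>f. arr X f \<Longrightarrow> G \<star> f = W \<star> R \<star> f" and a: "a \<in> Obj A"
  shows "\<exists>s. R.counit_inverse (FObj (LAdj J) a) s"
proof -
  interpret G: adjunction X A G J by fact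
  interpret W: cat_functor B A W by fact
  have G_obj: "FObj G x = FObj W (FObj R x)" if "x \<in> Obj X" for x
    using arg_cong[OF G[of "ide X x"], of src] that by simp
  let ?x = "FObj G.L a"
  have x: "?x \<in> Obj X" using a by simp
  define k where "k = (W \<star> R.\<eta> (FObj R ?x)) \<cdot>\<^bsub>A\<^esub> G.\<eta> a"
  have k: "arr A k" "src k = a" "tgt k = FObj G (FObj R.L (FObj R ?x))"
    using a G_obj by (simp_all add: k_def)
  define s where "s = G.\<epsilon> (FObj R.L (FObj R ?x)) \<cdot>\<^bsub>X\<^esub> (G.L \<star> k)"
  have s: "arr X s" "src s = ?x" "tgt s = FObj R.L (FObj R ?x)"
    using a k by (simp_all add: s_def)
  have Gs: "(G \<star> s) \<cdot>\<^bsub>A\<^esub> G.\<eta> a = k"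
    unfolding s_def by (rule G.transpose) (use a k in simp_all)
  have "R.\<epsilon> ?x \<cdot>\<^bsub>X\<^esub> s = ide X ?x"
  proof (rule G.eq_if_transpose_eq[OF a])
    have "W \<star> ((R \<star> R.\<epsilon> ?x) \<cdot>\<^bsub>B\<^esub> R.\<eta> (FObj R ?x)) = ide A (FObj G ?x)"
      using x by (simp only: R.triangle_G) (simp add: G_obj)
    then have W: "(G \<star> R.\<epsilon> ?x) \<cdot>\<^bsub>A\<^esub> (W \<star> R.\<eta> (FObj R ?x)) = ide A (FObj G ?x)"
      using x by (simp add: G del: R.triangle_G)
    have "(G \<star> (R.\<epsilon> ?x \<cdot>\<^bsub>X\<^esub> s)) \<cdot>\<^bsub>A\<^esub> G.\<eta> a = (G \<star> R.\<epsilon> ?x) \<cdot>\<^bsub>A\<^esub> k"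
      using s x a Gs by simp
    also have "\<dots> = G.\<eta> a"
      using x a G.right.target.cmp_reassoc[OF W] by (simp add: k_def G_obj)
    also have "\<dots> = (G \<star> ide X ?x) \<cdot>\<^bsub>A\<^esub> G.\<eta> a" using a by simp
    finally show "(G \<star> (R.\<epsilon> ?x \<cdot>\<^bsub>X\<^esub> s)) \<cdot>\<^bsub>A\<^esub> G.\<eta> a = (G \<star> ide X ?x) \<cdot>\<^bsub>A\<^esub> G.\<eta> a" .
  qed (use x s in simp_all)
  then show ?thesis using R.counit_inverseI[OF x s] by blast
qed

text \<open>
  The morphism \<open>u\<close> provides a retraction \<open>w\<close> of \<open>v = N \<eta>\<close>. The idempotent \<open>v w\<close> on \<open>R x\<close>, \<open>x = F a\<close>, comes from
  an endomorphism \<open>h\<close> of \<open>x\<close>, as \<open>x\<close> lies in the coreflective subcategory. Since \<open>v w v = v\<close> and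
  \<open>N\<close> is faithful, \<open>h\<close> has the same transpose as the identity, so \<open>v w\<close> is the identity.
\<close>

lemma unit_iso_if_factor:
  assumes "adjunction X A G J" and N: "cat_functor A B N" "faithful A N" "conservative A B N"
    and NG: "\<And>f. arr X f \<Longrightarrow> N \<star> G \<star> f = R \<star> f" and a: "a \<in> Obj A"
    and s: "R.counit_inverse (FObj (LAdj J) a) s"
    and u: "arr X u" "src u = FObj (LAdj J) a" "tgt u = FObj R.L (FObj N a)"
    and Ru: "(R \<star> u) \<cdot>\<^bsub>B\<^esub> (N \<star> unit_arr G J a) = R.\<eta> (FObj N a)"
  shows "invertible A (unit_arr G J a)"
proof -
  interpret G: adjunction X A G J by fact
  interpret N: cat_functor A B N by fact
  have NG_obj: "FObj N (FObj G x) = FObj R x" if "x \<in> Obj X" for x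
    using arg_cong[OF NG[of "ide X x"], of src] that by simp
  let ?x = "FObj G.L a" and ?b = "FObj N a"
  have x: "?x \<in> Obj X" and b: "?b \<in> Obj B" using a by simp_all
  obtain i where i: "arr B i" "src i = FObj R (FObj R.L ?b)" "tgt i = ?b"
    "i \<cdot>\<^bsub>B\<^esub> R.\<eta> ?b = ide B ?b"
    using R.unit_iso[OF b] by metis
  define v where "v = N \<star> G.\<eta> a"
  have v: "arr B v" "src v = ?b" "tgt v = FObj R ?x"
    using a x by (simp_all add: v_def NG_obj)
  define w where "w = i \<cdot>\<^bsub>B\<^esub> (R \<star> u)"
  have w: "arr B w" "src w = FObj R ?x" "tgt w = ?b"
    using i u by (simp_all add: w_def)
  have wv: "w \<cdot>\<^bsub>B\<^esub> v = ide B ?b"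
    using i u v Ru by (simp add: w_def v_def[symmetric])
  have s: "arr X s" "src s = ?x" "tgt s = FObj R.L (FObj R ?x)"
    "R.\<epsilon> ?x \<cdot>\<^bsub>X\<^esub> s = ide X ?x" "R \<star> s = R.\<eta> (FObj R ?x)"
    using s by (simp_all add: R.counit_inverse_def)
  define g where "g = v \<cdot>\<^bsub>B\<^esub> w"
  have g: "arr B g" "src g = FObj R ?x" "tgt g = FObj R ?x"
    using v w by (simp_all add: g_def)
  define h where "h = R.\<epsilon> ?x \<cdot>\<^bsub>X\<^esub> (R.L \<star> g) \<cdot>\<^bsub>X\<^esub> s"
  have h: "arr X h" "src h = ?x" "tgt h = ?x" using s g x by (simp_all add: h_def)
  have Rh: "R \<star> h = g" using s g x by (simp add: h_def R.unit_nat)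
  have gv: "g \<cdot>\<^bsub>B\<^esub> v = v" using v w wv by (simp add: g_def)
  have "N \<star> ((G \<star> h) \<cdot>\<^bsub>A\<^esub> G.\<eta> a) = N \<star> G.\<eta> a"
    using h a gv by (simp add: NG Rh v_def)
  then have Gh: "(G \<star> h) \<cdot>\<^bsub>A\<^esub> G.\<eta> a = G.\<eta> a"
    by (rule faithfulD[OF N(2), rotated -1]) (use h a in simp_all)
  have "h = ide X ?x"
    by (rule G.eq_if_transpose_eq[OF a]) (use h x a Gh in simp_all)
  then have "g = ide B (FObj R ?x)" using Rh x by simp
  then have "inverse_arrows B v w"
    using v w wv by (simp add: inverse_arrows_def g_def)
  then show ?thesis
    using N(3) a unfolding conservative_def invertible_def v_def by (metis G.arr_unit)
qed

text \<open>
  If \<open>G\<close> is a coreflection up to an isomorphism of its codomain, the factor is simply the transpose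
  of the unit of the coreflection.
\<close>

lemma unit_iso_if_codomain_isomorphic:
  assumes "adjunction X A G J" and "cat_functor A B N" and "cat_functor B A E"
    and EN: "\<And>f. arr A f \<Longrightarrow> E \<star> N \<star> f = f" and NE: "\<And>f. arr B f \<Longrightarrow> N \<star> E \<star> f = f"
    and NG: "\<And>f. arr X f \<Longrightarrow> N \<star> G \<star> f = R \<star> f" and a: "a \<in> Obj A"
    and counit: "\<exists>s. R.counit_inverse (FObj (LAdj J) a) s"
  shows "invertible A (unit_arr G J a)"
proof -
  interpret G: adjunction X A G J by fact
  interpret N: cat_functor A B N by fact
  interpret E: cat_functor B A E by fact
  let ?b = "FObj N a" and ?x = "FObj G.L a"
  have b: "?b \<in> Obj B" and x: "?x \<in> Obj X" using a by simp_all
  define y where "y = FObj R.L ?b"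
  have y: "y \<in> Obj X" using b by (simp add: y_def)
  have EN_obj: "FObj E (FObj N c) = c" if "c \<in> Obj A" for c
    using arg_cong[OF EN[of "ide A c"], of src] that by simp
  have NG_obj: "FObj N (FObj G z) = FObj R z" if "z \<in> Obj X" for z
    using arg_cong[OF NG[of "ide X z"], of src] that by simp
  have EG_obj: "FObj E (FObj R z) = FObj G z" if "z \<in> Obj X" for z
    using EN_obj[of "FObj G z"] NG_obj[OF that] that by simp
  define k where "k = E \<star> R.\<eta> ?b"
  have k: "arr A k" "src k = a" "tgt k = FObj G y"
    using b a y EN_obj EG_obj[OF y] by (simp_all add: k_def y_def)
  define u where "u = G.\<epsilon> y \<cdot>\<^bsub>X\<^esub> (G.L \<star> k)"
  have u: "arr X u" "src u = ?x" "tgt u = y" using k y by (simp_all add: u_def)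
  have "(G \<star> u) \<cdot>\<^bsub>A\<^esub> G.\<eta> a = k"
    unfolding u_def by (rule G.transpose) (use a y k in simp_all)
  from arg_cong[OF this, of "\<lambda>f. N \<star> f"]
  have Ru: "(R \<star> u) \<cdot>\<^bsub>B\<^esub> (N \<star> G.\<eta> a) = R.\<eta> ?b"
    using u a by (simp add: NG k_def NE)
  obtain s where s: "R.counit_inverse ?x s" using counit by blast
  have "faithful A N" unfolding faithful_def using EN by metis
  moreover have "conservative A B N" unfolding conservative_def using EN E.invertible_amap by metis
  ultimately show ?thesis
    using NG by (rule unit_iso_if_factor[OF G.adjunction_axioms N.cat_functor_axioms _ _ _ a s
          u(1,2) u(3)[unfolded y_def] Ru])
qed

end

section \<open>The left adjoint of the comparison functor as a coequalizer\<close>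

context comparison_step
begin

text \<open>
  The canonical map from the left adjoint at the underlying object of an algebra to the left adjoint
  of the comparison functor at the algebra. With \<open>F \<stileturn> G\<close> the base adjunction and \<open>h\<close> the structure
  map, it is the coequalizer of \<open>\<epsilon>\<close> and \<open>F h\<close>, as the lemmas below show.
\<close>

definition free_quotient :: "('o, 'm) tower_obj \<Rightarrow> ('x, 'y) arrow" where
  "free_quotient c = base.\<epsilon> (FObj step.L c) \<cdot>\<^bsub>X\<^esub> (base.L \<star> V \<star> step.\<eta> c)"

lemma
  assumes c: "c \<in> Obj A'"
  shows arr_free_quotient [simp]: "arr X (free_quotient c)"
    and src_tgt_free_quotient [simp]: "src (free_quotient c) = FObj base.L (FObj V c)"
      "tgt (free_quotient c) = FObj step.L c"
    and quotient_unit: "(G \<star> free_quotient c) \<cdot>\<^bsub>A\<^esub> base.\<eta> (FObj V c) = V \<star> step.\<eta> c"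
    and comparison_quotient: "G' \<star> free_quotient c = step.\<eta> c \<cdot>\<^bsub>A'\<^esub> free_action c"
proof -
  have *: "FObj step.L c \<in> Obj X" using c by simp
  show q: "arr X (free_quotient c)" "src (free_quotient c) = FObj base.L (FObj V c)"
    "tgt (free_quotient c) = FObj step.L c"
    using c by (simp_all add: free_quotient_def)
  show "(G \<star> free_quotient c) \<cdot>\<^bsub>A\<^esub> base.\<eta> (FObj V c) = V \<star> step.\<eta> c"
    unfolding free_quotient_def by (rule base.transpose) (use c in simp_all)
  show "G' \<star> free_quotient c = step.\<eta> c \<cdot>\<^bsub>A'\<^esub> free_action c"
  proof (rule forget_eqI)
    show "V \<star> G' \<star> free_quotient c = V \<star> (step.\<eta> c \<cdot>\<^bsub>A'\<^esub> free_action c)"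
      using c arr_step_nat[of "step.\<eta> c"] by (simp add: free_quotient_def)
  qed (use q c in simp_all)
qed

lemma quotient_coequalizes:
  assumes c: "c \<in> Obj A'"
  shows "free_quotient c \<cdot>\<^bsub>X\<^esub> base.\<epsilon> (FObj base.L (FObj V c)) = free_quotient c \<cdot>\<^bsub>X\<^esub> (base.L \<star> \<alpha> c)"
proof (rule base.eq_if_transpose_eq[of "FObj G (FObj base.L (FObj V c))"])
  let ?a = "FObj V c"
  have Gq: "G \<star> free_quotient c = (V \<star> step.\<eta> c) \<cdot>\<^bsub>A\<^esub> \<alpha> c"
    using arg_cong[OF comparison_quotient[OF c], of "\<lambda>f. V \<star> f"] c by simp
  show "(G \<star> (free_quotient c \<cdot>\<^bsub>X\<^esub> base.\<epsilon> (FObj base.L ?a))) \<cdot>\<^bsub>A\<^esub> base.\<eta> (FObj G (FObj base.L ?a)) =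
      (G \<star> (free_quotient c \<cdot>\<^bsub>X\<^esub> (base.L \<star> \<alpha> c))) \<cdot>\<^bsub>A\<^esub> base.\<eta> (FObj G (FObj base.L ?a))"
    using c base.right.target.cmp_reassoc[OF \<alpha>_unit[OF c]] by (simp add: Gq base.unit_nat)
qed (use c in simp_all)

text \<open>
  The condition on \<open>m\<close> says exactly that its transpose is a morphism of algebras into \<open>G' x\<close>, where
  \<open>x\<close> is the target of \<open>m\<close>. Such morphisms correspond to maps out of the left adjoint of the
  comparison functor.
\<close>

lemma quotient_universal:
  assumes c: "c \<in> Obj A'" and m: "arr X m" "src m = FObj base.L (FObj V c)"
    and coeq: "m \<cdot>\<^bsub>X\<^esub> base.\<epsilon> (FObj base.L (FObj V c)) = m \<cdot>\<^bsub>X\<^esub> (base.L \<star> \<alpha> c)"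
  obtains u where "arr X u" "src u = FObj step.L c" "tgt u = tgt m" "u \<cdot>\<^bsub>X\<^esub> free_quotient c = m"
proof -
  let ?a = "FObj V c" and ?x = "tgt m"
  have a: "?a \<in> Obj A" and x: "?x \<in> Obj X" using c m by simp_all
  define k where "k = (G \<star> m) \<cdot>\<^bsub>A\<^esub> base.\<eta> ?a"
  have k: "arr A k" "src k = ?a" "tgt k = FObj G ?x" using m a by (simp_all add: k_def)
  define k' where "k' = Arrow c (mor k) (FObj G' ?x)"
  have Vk': "V \<star> k' = k" "src k' = c" "tgt k' = FObj G' ?x" using k by (simp_all add: k'_def)
  have Gm: "(G \<star> m) \<cdot>\<^bsub>A\<^esub> (G \<star> base.L \<star> \<alpha> c) = (G \<star> m) \<cdot>\<^bsub>A\<^esub> (G \<star> base.\<epsilon> (FObj base.L ?a))"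
    using arg_cong[OF coeq, of "\<lambda>f. G \<star> f"] m c by simp
  have "k \<cdot>\<^bsub>A\<^esub> \<alpha> c = (G \<star> m) \<cdot>\<^bsub>A\<^esub> (G \<star> base.L \<star> \<alpha> c) \<cdot>\<^bsub>A\<^esub> base.\<eta> (FObj G (FObj base.L ?a))"
    using m c by (simp add: k_def base.unit_nat)
  also have "\<dots> = G \<star> m"
    using base.right.target.cmp_reassoc[OF Gm] m c by simp
  also have "\<dots> = (G \<star> base.\<epsilon> ?x) \<cdot>\<^bsub>A\<^esub> (G \<star> base.L \<star> k)"
    using arg_cong[OF base.transpose_transpose[OF a m], of "\<lambda>f. G \<star> f"] k x
    by (simp add: k_def[symmetric])
  finally have k': "arr A' k'"
    unfolding arr_step_iff[of k'] using c x k by (simp add: Vk')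
  define u where "u = step.\<epsilon> ?x \<cdot>\<^bsub>X\<^esub> (step.L \<star> k')"
  have u: "arr X u" "src u = FObj step.L c" "tgt u = ?x"
    using k' Vk' x by (simp_all add: u_def)
  have G'u: "(G' \<star> u) \<cdot>\<^bsub>A'\<^esub> step.\<eta> c = k'"
    unfolding u_def by (rule step.transpose) (use c x k' Vk' in simp_all)
  have "u \<cdot>\<^bsub>X\<^esub> free_quotient c = m"
  proof (rule base.eq_if_transpose_eq[OF a])
    have "(G \<star> (u \<cdot>\<^bsub>X\<^esub> free_quotient c)) \<cdot>\<^bsub>A\<^esub> base.\<eta> ?a = (G \<star> u) \<cdot>\<^bsub>A\<^esub> (V \<star> step.\<eta> c)"
      using u c quotient_unit[OF c] by simp
    also have "\<dots> = k"
      using arg_cong[OF G'u, of "\<lambda>f. V \<star> f"] u c by (simp add: Vk')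
    finally show "(G \<star> (u \<cdot>\<^bsub>X\<^esub> free_quotient c)) \<cdot>\<^bsub>A\<^esub> base.\<eta> ?a = (G \<star> m) \<cdot>\<^bsub>A\<^esub> base.\<eta> ?a"
      by (simp add: k_def)
  qed (use u m c in simp_all)
  then show thesis using that u by blast
qed

lemma quotient_epi:
  assumes c: "c \<in> Obj A'" and u: "arr X u" "src u = FObj step.L c"
    and u': "arr X u'" "src u' = FObj step.L c" "tgt u = tgt u'"
    and eq: "u \<cdot>\<^bsub>X\<^esub> free_quotient c = u' \<cdot>\<^bsub>X\<^esub> free_quotient c"
  shows "u = u'"
proof (rule step.eq_if_transpose_eq[OF c u u'])
  have V: "V \<star> ((G' \<star> w) \<cdot>\<^bsub>A'\<^esub> step.\<eta> c) = (G \<star> (w \<cdot>\<^bsub>X\<^esub> free_quotient c)) \<cdot>\<^bsub>A\<^esub> base.\<eta> (FObj V c)"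
    if "arr X w" "src w = FObj step.L c" for w
    using that c quotient_unit[OF c] by simp
  show "(G' \<star> u) \<cdot>\<^bsub>A'\<^esub> step.\<eta> c = (G' \<star> u') \<cdot>\<^bsub>A'\<^esub> step.\<eta> c"
    by (rule forget_eqI) (use u u' V[OF u] V[OF u'(1,2)] eq in simp_all)
qed

end

context comparison_step
begin

context
  fixes B :: "('p, 'q) cat" and R JR
  assumes refl: "coreflective X B R JR"
    and counit_inv: "\<And>a. a \<in> Obj A \<Longrightarrow> \<exists>s. coreflective.counit_inverse X R JR (FObj (LAdj J) a) s"
begin

interpretation R: coreflective X B R JR by (rule refl)

text \<open>
  Maps from \<open>R F a\<close> to \<open>b\<close> are maps from \<open>F a\<close> to \<open>L b\<close> because \<open>F a\<close> lies in the coreflective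
  subcategory. The same holds for \<open>F G F a\<close>, so coequalizing can be tested on either side.
\<close>

lemma factor_through_quotient:
  assumes c: "c \<in> Obj A'" and s: "R.counit_inverse (FObj base.L (FObj V c)) s"
    and p: "arr B p" "src p = FObj R (FObj base.L (FObj V c))"
    and coeq: "p \<cdot>\<^bsub>B\<^esub> (R \<star> base.\<epsilon> (FObj base.L (FObj V c))) = p \<cdot>\<^bsub>B\<^esub> (R \<star> base.L \<star> \<alpha> c)"
  obtains u where "arr X u" "src u = FObj step.L c" "tgt u = FObj R.L (tgt p)"
    "u \<cdot>\<^bsub>X\<^esub> free_quotient c = (R.L \<star> p) \<cdot>\<^bsub>X\<^esub> s"
proof -
  let ?x = "FObj base.L (FObj V c)"
  let ?e = "base.\<epsilon> ?x" and ?l = "base.L \<star> \<alpha> c"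
  have e: "arr X ?e" "arr X ?l" "src ?e = FObj base.L (FObj G ?x)" "src ?l = FObj base.L (FObj G ?x)"
    "tgt ?e = ?x" "tgt ?l = ?x"
    using c by simp_all
  obtain t where t: "R.counit_inverse (FObj base.L (FObj G ?x)) t"
    using counit_inv[of "FObj G ?x"] c by auto
  have nat: "s \<cdot>\<^bsub>X\<^esub> ?e = (R.L \<star> R \<star> ?e) \<cdot>\<^bsub>X\<^esub> t" "s \<cdot>\<^bsub>X\<^esub> ?l = (R.L \<star> R \<star> ?l) \<cdot>\<^bsub>X\<^esub> t"
    by (rule R.counit_inverse_nat; use e s t in simp)+
  have s': "arr X s" "src s = ?x" "tgt s = FObj R.L (FObj R ?x)"
    and t': "arr X t" "src t = FObj base.L (FObj G ?x)" "tgt t = FObj R.L (FObj R (FObj base.L (FObj G ?x)))"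
    using s t by (simp_all add: R.counit_inverse_def)
  have Lp: "(R.L \<star> p) \<cdot>\<^bsub>X\<^esub> (R.L \<star> R \<star> ?e) = (R.L \<star> p) \<cdot>\<^bsub>X\<^esub> (R.L \<star> R \<star> ?l)"
    using arg_cong[OF coeq, of "\<lambda>f. R.L \<star> f"] p c by simp
  have "((R.L \<star> p) \<cdot>\<^bsub>X\<^esub> s) \<cdot>\<^bsub>X\<^esub> ?e = (R.L \<star> p) \<cdot>\<^bsub>X\<^esub> (R.L \<star> R \<star> ?e) \<cdot>\<^bsub>X\<^esub> t"
    using p s' e by (simp add: nat)
  also have "\<dots> = (R.L \<star> p) \<cdot>\<^bsub>X\<^esub> (R.L \<star> R \<star> ?l) \<cdot>\<^bsub>X\<^esub> t"
    using base.right.source.cmp_reassoc[OF Lp] p t' c by simp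
  also have "\<dots> = ((R.L \<star> p) \<cdot>\<^bsub>X\<^esub> s) \<cdot>\<^bsub>X\<^esub> ?l"
    using p s' e by (simp add: nat)
  finally have *: "((R.L \<star> p) \<cdot>\<^bsub>X\<^esub> s) \<cdot>\<^bsub>X\<^esub> ?e = ((R.L \<star> p) \<cdot>\<^bsub>X\<^esub> s) \<cdot>\<^bsub>X\<^esub> ?l" .
  show thesis
    by (rule quotient_universal[OF c _ _ *]) (use p s' that in auto)
qed

text \<open>
  The coreflective subcategory is closed under the coequalizer: a section of the counit is induced by
  the section at \<open>F a\<close>.
\<close>

lemma counit_iso_at_step_left_adjoint:
  assumes c: "c \<in> Obj A'"
  shows "\<exists>s. R.counit_inverse (FObj step.L c) s"
proof -
  let ?q = "free_quotient c" and ?x = "FObj base.L (FObj V c)" and ?y = "FObj step.L c"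
  have q: "arr X ?q" "src ?q = ?x" "tgt ?q = ?y" and y: "?y \<in> Obj X" using c by simp_all
  obtain t where t: "R.counit_inverse ?x t" using counit_inv[OF Obj_forget[OF c]] by blast
  have t': "arr X t" "src t = ?x" "tgt t = FObj R.L (FObj R ?x)" "R.\<epsilon> ?x \<cdot>\<^bsub>X\<^esub> t = ide X ?x"
    using t by (simp_all add: R.counit_inverse_def)
  have "R \<star> (?q \<cdot>\<^bsub>X\<^esub> base.\<epsilon> ?x) = R \<star> (?q \<cdot>\<^bsub>X\<^esub> (base.L \<star> \<alpha> c))"
    by (simp only: quotient_coequalizes[OF c])
  then obtain s where s: "arr X s" "src s = ?y" "tgt s = FObj R.L (tgt (R \<star> ?q))"
      "s \<cdot>\<^bsub>X\<^esub> ?q = (R.L \<star> R \<star> ?q) \<cdot>\<^bsub>X\<^esub> t"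
    using factor_through_quotient[OF c t, of "R \<star> ?q"] c by auto
  have "R.\<epsilon> ?y \<cdot>\<^bsub>X\<^esub> s = ide X ?y"
  proof (rule quotient_epi[OF c])
    have "(R.\<epsilon> ?y \<cdot>\<^bsub>X\<^esub> s) \<cdot>\<^bsub>X\<^esub> ?q = R.\<epsilon> ?y \<cdot>\<^bsub>X\<^esub> (R.L \<star> R \<star> ?q) \<cdot>\<^bsub>X\<^esub> t"
      using s q y by simp
    also have "\<dots> = ?q \<cdot>\<^bsub>X\<^esub> R.\<epsilon> ?x \<cdot>\<^bsub>X\<^esub> t"
      using base.right.source.cmp_reassoc[OF R.counit_nat[OF q(1) q(3)]] t' q y c by simp
    also have "\<dots> = ide X ?y \<cdot>\<^bsub>X\<^esub> ?q" using t' q by simp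
    finally show "(R.\<epsilon> ?y \<cdot>\<^bsub>X\<^esub> s) \<cdot>\<^bsub>X\<^esub> ?q = ide X ?y \<cdot>\<^bsub>X\<^esub> ?q" .
  qed (use s y q in simp_all)
  then show ?thesis
    using R.counit_inverseI[of ?y s] s y q by auto
qed

text \<open>
  The image \<open>p : R F a \<rightarrow> N' c\<close> of the action of the free algebra is an epimorphism because \<open>U\<close> sends it
  to a split one. It coequalizes the image under \<open>R\<close> of the pair whose coequalizer is the left
  adjoint at \<open>c\<close>, so it yields a map from this left adjoint to \<open>L N' c\<close>. The equation that
  \<open>unit_iso_if_factor\<close> requires of this map can be checked after precomposition with \<open>p\<close>.
\<close>

theorem unit_iso_at_lift:
  assumes N: "cat_functor A D N" and U: "cat_functor B D U" "faithful B U"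
    and N': "cat_functor A' B N'" "faithful A' N'" "conservative A' B N'"
    and N'G': "\<And>f. arr X f \<Longrightarrow> N' \<star> G' \<star> f = R \<star> f"
    and UN': "\<And>f. arr A' f \<Longrightarrow> U \<star> N' \<star> f = N \<star> V \<star> f" and c: "c \<in> Obj A'"
  shows "invertible A' (step.\<eta> c)"
proof -
  interpret N: cat_functor A D N by (rule N)
  interpret U: cat_functor B D U by (rule U)
  interpret N': cat_functor A' B N' by (rule N')
  have N'G'_obj: "FObj N' (FObj G' x) = FObj R x" if "x \<in> Obj X" for x
    using arg_cong[OF N'G'[of "ide X x"], of src] that by simp
  have UN'_obj: "FObj U (FObj N' b) = FObj N (FObj V b)" if "b \<in> Obj A'" for b
    using arg_cong[OF UN'[of "ide A' b"], of src] that by simp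
  let ?x = "FObj base.L (FObj V c)" and ?b = "FObj N' c"
  have x: "?x \<in> Obj X" and b: "?b \<in> Obj B" using c by simp_all
  define p where "p = N' \<star> free_action c"
  have p: "arr B p" "src p = FObj R ?x" "tgt p = ?b"
    using c x by (simp_all add: p_def N'G'_obj)
  have Up: "U \<star> p = N \<star> \<alpha> c" using c by (simp add: p_def UN')
  have p_epi: "g = h" if g: "arr B g" "src g = ?b" and h: "arr B h" "src h = ?b" "tgt g = tgt h"
      and eq: "g \<cdot>\<^bsub>B\<^esub> p = h \<cdot>\<^bsub>B\<^esub> p" for g h
  proof (rule faithfulD[OF U(2) g(1) h(1)])
    have "U \<star> (g \<cdot>\<^bsub>B\<^esub> p) = U \<star> (h \<cdot>\<^bsub>B\<^esub> p)" using eq by simp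
    then have *: "(U \<star> g) \<cdot>\<^bsub>D\<^esub> (N \<star> \<alpha> c) = (U \<star> h) \<cdot>\<^bsub>D\<^esub> (N \<star> \<alpha> c)"
      using g h p by (simp add: Up)
    have "N \<star> (\<alpha> c \<cdot>\<^bsub>A\<^esub> base.\<eta> (FObj V c)) = ide D (FObj N (FObj V c))"
      using c by simp
    then have **: "(N \<star> \<alpha> c) \<cdot>\<^bsub>D\<^esub> (N \<star> base.\<eta> (FObj V c)) = ide D (tgt (N \<star> \<alpha> c))"
      using c by (simp del: \<alpha>_unit)
    show "U \<star> g = U \<star> h"
      by (rule N.target.split_epi_cancel[OF ** _ _ _ _ _ _ _ *]) (use c g h UN'_obj in simp_all)
  qed (use g h in simp_all)
  have "free_action c \<cdot>\<^bsub>A'\<^esub> (G' \<star> base.\<epsilon> ?x) = free_action c \<cdot>\<^bsub>A'\<^esub> (G' \<star> base.L \<star> \<alpha> c)"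
    by (rule forget_eqI) (use c x \<alpha>_assoc[OF c] in simp_all)
  from arg_cong[OF this, of "\<lambda>f. N' \<star> f"]
  have coeq: "p \<cdot>\<^bsub>B\<^esub> (R \<star> base.\<epsilon> ?x) = p \<cdot>\<^bsub>B\<^esub> (R \<star> base.L \<star> \<alpha> c)"
    using c x by (simp add: p_def N'G')
  obtain s where s: "R.counit_inverse ?x s" using counit_inv[OF Obj_forget[OF c]] by blast
  have s': "arr X s" "src s = ?x" "tgt s = FObj R.L (FObj R ?x)" "R \<star> s = R.\<eta> (FObj R ?x)"
    using s by (simp_all add: R.counit_inverse_def)
  obtain u where u: "arr X u" "src u = FObj step.L c" "tgt u = FObj R.L ?b"
      "u \<cdot>\<^bsub>X\<^esub> free_quotient c = (R.L \<star> p) \<cdot>\<^bsub>X\<^esub> s"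
    using factor_through_quotient[OF c s p(1,2) coeq] p(3) by metis
  obtain t where t: "R.counit_inverse (FObj step.L c) t"
    using counit_iso_at_step_left_adjoint[OF c] by blast
  have N'\<eta>: "arr B (N' \<star> step.\<eta> c)" "src (N' \<star> step.\<eta> c) = ?b" "tgt (N' \<star> step.\<eta> c) = FObj R (FObj step.L c)"
    using c by (simp_all add: N'G'_obj)
  have N'\<eta>p: "(N' \<star> step.\<eta> c) \<cdot>\<^bsub>B\<^esub> p = R \<star> free_quotient c"
    using arg_cong[OF comparison_quotient[OF c], of "\<lambda>f. N' \<star> f"] c by (simp add: p_def N'G')
  have Ru: "(R \<star> u) \<cdot>\<^bsub>B\<^esub> (N' \<star> step.\<eta> c) = R.\<eta> ?b"
  proof (rule p_epi)
    have "((R \<star> u) \<cdot>\<^bsub>B\<^esub> (N' \<star> step.\<eta> c)) \<cdot>\<^bsub>B\<^esub> p = (R \<star> u) \<cdot>\<^bsub>B\<^esub> (R \<star> free_quotient c)"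
      using u(1-3) p N'\<eta> by (simp add: N'\<eta>p)
    also have "\<dots> = (R \<star> R.L \<star> p) \<cdot>\<^bsub>B\<^esub> R.\<eta> (FObj R ?x)"
      using arg_cong[OF u(4), of "\<lambda>f. R \<star> f"] u(1-3) p s' c by simp
    also have "\<dots> = R.\<eta> ?b \<cdot>\<^bsub>B\<^esub> p"
      using p R.unit_nat[OF p(1)] by simp
    finally show "((R \<star> u) \<cdot>\<^bsub>B\<^esub> (N' \<star> step.\<eta> c)) \<cdot>\<^bsub>B\<^esub> p = R.\<eta> ?b \<cdot>\<^bsub>B\<^esub> p" .
  qed (use u N'\<eta> b in simp_all)
  show ?thesis
    by (rule unit_iso_if_factor[OF refl step.adjunction_axioms N' _ c t u(1-3) Ru]) (rule N'G')
qed

end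

end

section \<open>Invertible units are preserved along the tower\<close>

context comparison_step
begin

context
  assumes unit_iso: "\<And>a. a \<in> Obj A \<Longrightarrow> invertible A (base.\<eta> a)"
begin

lemma \<alpha>_inverse:
  assumes c: "c \<in> Obj A'"
  shows "base.\<eta> (FObj V c) \<cdot>\<^bsub>A\<^esub> \<alpha> c = ide A (FObj G (FObj base.L (FObj V c)))"
proof -
  obtain v where v: "arr A v" "src v = FObj G (FObj base.L (FObj V c))" "tgt v = FObj V c"
    "base.\<eta> (FObj V c) \<cdot>\<^bsub>A\<^esub> v = ide A (FObj G (FObj base.L (FObj V c)))"
    using unit_iso[of "FObj V c"] c by (auto simp: invertible_def inverse_arrows_def)
  have "v = \<alpha> c \<cdot>\<^bsub>A\<^esub> base.\<eta> (FObj V c) \<cdot>\<^bsub>A\<^esub> v"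
    using base.right.target.cmp_reassoc[OF \<alpha>_unit[OF c]] v(1-3) c by simp
  also have "\<dots> = \<alpha> c" unfolding v(4) using c by simp
  finally show ?thesis using v(4) by simp
qed

text \<open>
  The unit of the base adjunction is an isomorphism of algebras \<open>c \<cong> G' F a\<close>. Its transpose \<open>u\<close> is
  inverse to the canonical map \<open>F a \<rightarrow> F' c\<close>, and the inverse of the unit at \<open>c\<close> is \<open>G' u\<close>
  followed by the action.
\<close>

lemma step_unit_iso:
  assumes c: "c \<in> Obj A'"
  shows "invertible A' (step.\<eta> c)"
proof -
  let ?a = "FObj V c"
  let ?x = "FObj base.L ?a"
  have a: "?a \<in> Obj A" and x: "?x \<in> Obj X" using c by simp_all
  define e where "e = Arrow c (mor (base.\<eta> ?a)) (FObj G' ?x)"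
  have Ve: "V \<star> e = base.\<eta> ?a" "src e = c" "tgt e = FObj G' ?x"
    using a by (simp_all add: e_def)
  have "(G \<star> base.\<epsilon> ?x) \<cdot>\<^bsub>A\<^esub> (G \<star> base.L \<star> base.\<eta> ?a) = ide A (FObj G ?x)"
    using arg_cong[OF base.triangle_L[OF a], of "\<lambda>f. G \<star> f"] x a by (simp del: base.triangle_L)
  then have e: "arr A' e"
    unfolding arr_step_iff[of e] using c x a \<alpha>_inverse[OF c] by (simp add: Ve)
  have ae: "free_action c \<cdot>\<^bsub>A'\<^esub> e = ide A' c"
    by (rule forget_eqI) (use c e Ve in simp_all)
  define u where "u = step.\<epsilon> ?x \<cdot>\<^bsub>X\<^esub> (step.L \<star> e)"
  have u: "arr X u" "src u = FObj step.L c" "tgt u = ?x"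
    using e Ve x by (simp_all add: u_def)
  have G'u: "(G' \<star> u) \<cdot>\<^bsub>A'\<^esub> step.\<eta> c = e"
    unfolding u_def by (rule step.transpose) (use c x e Ve in simp_all)
  have qu: "free_quotient c \<cdot>\<^bsub>X\<^esub> u = ide X (FObj step.L c)"
  proof (rule step.eq_if_transpose_eq[OF c])
    have "(G' \<star> (free_quotient c \<cdot>\<^bsub>X\<^esub> u)) \<cdot>\<^bsub>A'\<^esub> step.\<eta> c = (step.\<eta> c \<cdot>\<^bsub>A'\<^esub> free_action c) \<cdot>\<^bsub>A'\<^esub> e"
      using u c e Ve by (simp add: G'u comparison_quotient)
    also have "\<dots> = step.\<eta> c" using c e Ve ae by simp
    finally show "(G' \<star> (free_quotient c \<cdot>\<^bsub>X\<^esub> u)) \<cdot>\<^bsub>A'\<^esub> step.\<eta> c =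
        (G' \<star> ide X (FObj step.L c)) \<cdot>\<^bsub>A'\<^esub> step.\<eta> c"
      using c by simp
  qed (use u c in simp_all)
  have "step.\<eta> c \<cdot>\<^bsub>A'\<^esub> free_action c \<cdot>\<^bsub>A'\<^esub> (G' \<star> u) = G' \<star> (free_quotient c \<cdot>\<^bsub>X\<^esub> u)"
    using u c by (simp add: comparison_quotient)
  then have "inverse_arrows A' (step.\<eta> c) (free_action c \<cdot>\<^bsub>A'\<^esub> (G' \<star> u))"
    using c u G'u ae qu by (simp add: inverse_arrows_def)
  then show ?thesis unfolding invertible_def by blast
qed

text \<open>
  An algebra structure is a retraction of the unit, so it is unique, and by naturality every morphism
  is a morphism of algebras. Conversely the inverse of the unit is an algebra structure: it is
  associative because \<open>G \<epsilon>\<close> and the image of this inverse under \<open>G F\<close> are both left inverse to the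
  invertible arrow \<open>G F \<eta>\<close>.
\<close>

theorem forget_isomorphism: "cat_isomorphism A' A V"
proof -
  define v where "v = (\<lambda>a. SOME v. inverse_arrows A (base.\<eta> a) v)"
  have "inverse_arrows A (base.\<eta> a) (v a)" if "a \<in> Obj A" for a
    using unit_iso[OF that] unfolding invertible_def v_def by (rule someI_ex)
  then have v: "arr A (v a)" "src (v a) = FObj G (FObj base.L a)" "tgt (v a) = a"
    "v a \<cdot>\<^bsub>A\<^esub> base.\<eta> a = ide A a" "base.\<eta> a \<cdot>\<^bsub>A\<^esub> v a = ide A (FObj G (FObj base.L a))"
    if "a \<in> Obj A" for a
    using that by (simp_all add: inverse_arrows_def)
  define W :: "(('o, 'm) tower_obj, 'm, ('o, 'm) tower_obj, 'm) func" where
    "W = \<lparr>FObj = \<lambda>a. Alg (a, mor (v a)), FHom = \<lambda>a b f. f\<rparr>"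
  have VW_obj: "FObj V (FObj W a) = a" for a
    by (simp add: W_def FObj_forget)
  have \<alpha>W: "\<alpha> (FObj W a) = v a" if "a \<in> Obj A" for a
    using v[OF that] VW_obj[of a]
    by (intro arrow_eqI) (simp_all, simp add: \<alpha>_def W_def base.structure_arr_def)
  have VW: "V \<star> W \<star> f = f" for f
    by (rule arrow_eqI) (simp_all add: VW_obj, simp add: W_def amap_def)
  have W_obj: "FObj W a \<in> Obj A'" if a: "a \<in> Obj A" for a
  proof -
    let ?x = "FObj base.L a"
    have x: "?x \<in> Obj X" using a by simp
    have e: "(G \<star> base.\<epsilon> ?x) \<cdot>\<^bsub>A\<^esub> (G \<star> base.L \<star> base.\<eta> a) = ide A (FObj G ?x)"
      using arg_cong[OF base.triangle_L[OF a], of "\<lambda>f. G \<star> f"] x a by (simp del: base.triangle_L)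
    have "G \<star> base.L \<star> (base.\<eta> a \<cdot>\<^bsub>A\<^esub> v a) = ide A (FObj G (FObj base.L (FObj G ?x)))"
      using v(5)[OF a] x by simp
    then have i: "(G \<star> base.L \<star> base.\<eta> a) \<cdot>\<^bsub>A\<^esub> (G \<star> base.L \<star> v a) =
        ide A (FObj G (FObj base.L (FObj G ?x)))"
      using v(1-3)[OF a] a by simp
    have "G \<star> base.\<epsilon> ?x = (G \<star> base.\<epsilon> ?x) \<cdot>\<^bsub>A\<^esub> (G \<star> base.L \<star> base.\<eta> a) \<cdot>\<^bsub>A\<^esub> (G \<star> base.L \<star> v a)"
      unfolding i using x by simp
    also have "\<dots> = G \<star> base.L \<star> v a"
      using base.right.target.cmp_reassoc[OF e] v(1-3)[OF a] a by simp
    finally have "v a \<cdot>\<^bsub>A\<^esub> (G \<star> base.\<epsilon> ?x) = v a \<cdot>\<^bsub>A\<^esub> (G \<star> base.L \<star> v a)"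
      by simp
    then show ?thesis
      unfolding Obj_step_iff \<alpha>W[OF a] VW_obj using v[OF a] by (simp add: W_def)
  qed
  have arr_W: "arr A' (W \<star> f)" if f: "arr A f" for f
  proof -
    let ?a = "src f" and ?b = "tgt f"
    have ab: "?a \<in> Obj A" "?b \<in> Obj A" using f by simp_all
    have "f \<cdot>\<^bsub>A\<^esub> v ?a = v ?b \<cdot>\<^bsub>A\<^esub> (base.\<eta> ?b \<cdot>\<^bsub>A\<^esub> f) \<cdot>\<^bsub>A\<^esub> v ?a"
      using base.right.target.cmp_reassoc[OF v(4)[OF ab(2)]] v(1-3)[OF ab(1)] v(1-3)[OF ab(2)] f
      by simp
    also have "\<dots> = v ?b \<cdot>\<^bsub>A\<^esub> (G \<star> base.L \<star> f) \<cdot>\<^bsub>A\<^esub> base.\<eta> ?a \<cdot>\<^bsub>A\<^esub> v ?a"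
      unfolding base.unit_nat[OF f refl, symmetric] using v(1-3)[OF ab(1)] v(1-3)[OF ab(2)] f by simp
    also have "\<dots> = v ?b \<cdot>\<^bsub>A\<^esub> (G \<star> base.L \<star> f)"
      unfolding v(5)[OF ab(1)] using v(1-3)[OF ab(2)] f by simp
    finally show ?thesis
      unfolding arr_step_iff[of "W \<star> f"] using f by (simp add: VW \<alpha>W W_obj)
  qed
  have W: "cat_functor A A' W"
  proof (rule cat_functor_arrI)
    show "category A" "category A'" by unfold_locales
    show "FObj W a \<in> Obj A'" if "a \<in> Obj A" for a by (rule W_obj[OF that])
    show "arr A' (W \<star> f)" if "arr A f" for f by (rule arr_W[OF that])
    show "W \<star> ide A a = ide A' (FObj W a)" if "a \<in> Obj A" for a
      by (rule forget_eqI) (use that W_obj in \<open>simp_all add: VW VW_obj\<close>)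
    show "W \<star> (g \<cdot>\<^bsub>A\<^esub> f) = (W \<star> g) \<cdot>\<^bsub>A'\<^esub> (W \<star> f)"
      if "arr A f" "arr A g" "tgt f = src g" for f g
      by (rule forget_eqI) (use that arr_W in \<open>simp_all add: VW\<close>)
  qed
  have WV_obj: "FObj W (FObj V c) = c" if c: "c \<in> Obj A'" for c
  proof (rule \<alpha>_inject)
    let ?a = "FObj V c"
    have a: "?a \<in> Obj A" using c by simp
    have "v ?a = v ?a \<cdot>\<^bsub>A\<^esub> base.\<eta> ?a \<cdot>\<^bsub>A\<^esub> \<alpha> c"
      unfolding \<alpha>_inverse[OF c] using v(1-3)[OF a] by simp
    also have "\<dots> = \<alpha> c"
      using base.right.target.cmp_reassoc[OF v(4)[OF a]] v(1-3)[OF a] c by simp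
    finally show "\<alpha> (FObj W ?a) = \<alpha> c" using \<alpha>W[OF a] by simp
  qed (use c W_obj in simp_all)
  have WV: "W \<star> V \<star> f = f" if "arr A' f" for f
    by (rule forget_eqI) (use that WV_obj in \<open>simp_all add: VW\<close>)
  show ?thesis
    unfolding cat_isomorphism_def
    using forget_functor W WV VW
    by (auto simp: step.right.target.func_eq_on_iff base.right.target.func_eq_on_iff amap_comp_func)
qed

end

end

section \<open>The tower\<close>

lemma tower_step:
  assumes "tower_adjunctions X A G J"
  shows "comparison_step X (tower_cat A G J k) (tower_func A G J k) (J k) (J (Suc k))"
proof -
  have "adjunction X (tower_cat A G J k) (tower_func A G J k) (J k)"
    and "adjunction X (tower_cat A G J (Suc k)) (tower_func A G J (Suc k)) (J (Suc k))"
    using assms by (simp_all only: tower_adjunctions_def)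
  then show ?thesis by (simp add: comparison_step_def Let_def)
qed

lemma tower_Suc:
  "tower_cat A G J (Suc k) = rename_cat Alg unAlg (EM (tower_cat A G J k) (induced_monad (tower_func A G J k) (J k)))"
  "tower_func A G J (Suc k) = rename_func Alg \<circ>\<^sub>F comparison (tower_func A G J k) (J k)"
  by (simp_all add: Let_def)

lemma tower_stabilizes_if_unit_iso:
  assumes tower: "tower_adjunctions X A G J"
    and "\<And>a. a \<in> Obj (tower_cat A G J n) \<Longrightarrow> invertible (tower_cat A G J n) (unit_arr (tower_func A G J n) (J n) a)"
  shows "tower_stabilizes_at A G J n"
  unfolding tower_stabilizes_at_def
proof (intro allI impI)
  fix j assume "n \<le> j"
  then have unit_iso: "invertible (tower_cat A G J j) (unit_arr (tower_func A G J j) (J j) a)"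
    if "a \<in> Obj (tower_cat A G J j)" for a
    using that
  proof (induction j arbitrary: a rule: dec_induct)
    case base
    then show ?case by (rule assms(2))
  next
    case (step j)
    interpret S: comparison_step X "tower_cat A G J j" "tower_func A G J j" "J j" "J (Suc j)"
      by (rule tower_step[OF tower])
    show ?case
      using S.step_unit_iso[OF step.IH] step.prems unfolding tower_Suc by simp
  qed
  interpret S: comparison_step X "tower_cat A G J j" "tower_func A G J j" "J j" "J (Suc j)"
    by (rule tower_step[OF tower])
  show "cat_isomorphism (tower_cat A G J (Suc j)) (tower_cat A G J j) tower_forget"
    using S.forget_isomorphism[OF unit_iso] unfolding tower_Suc by simp
qed

abbreviation level_zero :: "('o, 'm) cat \<Rightarrow> (('o, 'm) tower_obj, 'm) cat" where
  "level_zero A \<equiv> rename_cat Base unBase A"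

abbreviation to_level_zero :: "('o, 'm, ('o, 'm) tower_obj, 'm) func" where
  "to_level_zero \<equiv> rename_func Base"

abbreviation from_level_zero :: "(('o, 'm) tower_obj, 'm, 'o, 'm) func" where
  "from_level_zero \<equiv> rename_func unBase"

lemma base_copy:
  fixes A :: "('o, 'm) cat"
  assumes "category A" and A\<^sub>0: "category (level_zero A)"
  shows rename_Base: "cat_functor A (level_zero A) to_level_zero"
    and rename_unBase: "cat_functor (level_zero A) A from_level_zero"
    and "faithful (level_zero A) from_level_zero"
    and "conservative (level_zero A) A from_level_zero"
    and unBase_Base: "\<And>f :: ('o, 'm) arrow. from_level_zero \<star> to_level_zero \<star> f = f"
    and Base_unBase: "\<And>f. arr (level_zero A) f \<Longrightarrow>
      to_level_zero \<star> from_level_zero \<star> f = f"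
proof -
  let ?A = "level_zero A"
  interpret A: category A by fact
  interpret A': category ?A by fact
  have mor: "mor (rename_func e \<star> f) = mor f" for e f
    by (simp add: rename_func_def amap_def)
  have obj: "FObj (rename_func e) a = e a" for e a
    by (simp add: rename_func_def)
  show B: "cat_functor A ?A to_level_zero"
  proof (rule cat_functor_arrI)
    show "arr ?A (to_level_zero \<star> f)" if "arr A f" for f
      using that by (auto simp: arr_def obj mor rename_cat_def simp del: arr_src arr_tgt)
    show "to_level_zero \<star> ide A a = ide ?A (FObj to_level_zero a)" for a
      by (rule arrow_eqI) (simp_all add: mor, simp add: ide_def obj rename_cat_def)
    show "to_level_zero \<star> (g \<cdot>\<^bsub>A\<^esub> f) = (to_level_zero \<star> g) \<cdot>\<^bsub>?A\<^esub> (to_level_zero \<star> f)" for f g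
      by (rule arrow_eqI) (simp_all add: mor, simp add: cmp_def mor rename_cat_def)
  qed (use assms in \<open>auto simp: obj rename_cat_def\<close>)
  show U: "cat_functor ?A A from_level_zero"
  proof (rule cat_functor_arrI)
    show "arr A (from_level_zero \<star> f)" if "arr ?A f" for f
      using that by (auto simp: arr_def obj mor rename_cat_def simp del: arr_src arr_tgt)
    show "from_level_zero \<star> ide ?A a = ide A (FObj from_level_zero a)" for a
      by (rule arrow_eqI) (simp_all add: mor, simp add: ide_def obj rename_cat_def)
    show "from_level_zero \<star> (g \<cdot>\<^bsub>?A\<^esub> f) = (from_level_zero \<star> g) \<cdot>\<^bsub>A\<^esub> (from_level_zero \<star> f)" for f g
      by (rule arrow_eqI) (simp_all add: mor, simp add: cmp_def mor rename_cat_def)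
  qed (use assms in \<open>auto simp: obj rename_cat_def\<close>)
  show "from_level_zero \<star> to_level_zero \<star> f = f" for f :: "('o, 'm) arrow"
    by (rule arrow_eqI) (simp_all add: mor obj)
  show BU: "to_level_zero \<star> from_level_zero \<star> f = f" if "arr ?A f" for f
    by (rule arrow_eqI) (use arr_src[OF that] arr_tgt[OF that] in \<open>auto simp: mor obj rename_cat_def\<close>)
  interpret B: cat_functor A ?A "to_level_zero" by (rule B)
  show "faithful ?A from_level_zero"
    unfolding faithful_def using BU by metis
  show "conservative ?A A from_level_zero"
    unfolding conservative_def using BU B.invertible_amap by metis
qed

lemma tower_counit_inverse:
  assumes "category A" and tower: "tower_adjunctions X A G J" and refl: "coreflective X B R JR"
    and W: "cat_functor B A W" and G: "\<And>f. arr X f \<Longrightarrow> G \<star> f = W \<star> R \<star> f"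
    and a: "a \<in> Obj (tower_cat A G J k)"
  shows "\<exists>s. coreflective.counit_inverse X R JR (FObj (LAdj (J k)) a) s"
  using a
proof (induction k arbitrary: a)
  case 0
  interpret S: comparison_step X "tower_cat A G J 0" "tower_func A G J 0" "J 0" "J (Suc 0)"
    by (rule tower_step[OF tower])
  have "category (level_zero A)"
    using S.base.right.target.category_axioms by simp
  then have "cat_functor B (tower_cat A G J 0) (to_level_zero \<circ>\<^sub>F W)"
    using cat_functor_comp[OF W] rename_Base[OF assms(1)] by simp
  then show ?case
    by (rule counit_iso_at_left_adjoint[OF refl S.base.adjunction_axioms _ _ 0])
      (simp add: amap_comp_func G)
next
  case (Suc k)
  interpret S: comparison_step X "tower_cat A G J k" "tower_func A G J k" "J k" "J (Suc k)"
    by (rule tower_step[OF tower])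
  show ?case
    using S.counit_iso_at_step_left_adjoint[OF refl Suc.IH] Suc.prems unfolding tower_Suc by simp
qed

text \<open>
  The chain is defined by splitting off the innermost functor; the passage from step \<open>k\<close> to
  step \<open>k + 1\<close> of the tower uses up the outermost one.
\<close>

lemma comp_chain_Suc_left: "comp_chain U (Suc m) = U 1 \<circ>\<^sub>F comp_chain (\<lambda>i. U (Suc i)) m"
  by (induction m) (simp_all add: comp_func_def id_func_def)

lemma comp_chain_functor:
  assumes "category (B 0)" "\<And>i. i \<in> {1..n} \<Longrightarrow> cat_functor (B i) (B (i - 1)) (U i)"
  shows "cat_functor (B n) (B 0) (comp_chain U n)"
  using assms
proof (induction n)
  case 0
  then interpret category "B 0" by simp
  show ?case by unfold_locales (auto simp: id_func_def)
next
  case (Suc n)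
  have "cat_functor (B (Suc n)) (B n) (U (Suc n))" using Suc.prems(2)[of "Suc n"] by simp
  moreover have "cat_functor (B n) (B 0) (comp_chain U n)" using Suc by simp
  ultimately show ?case by (simp add: cat_functor_comp)
qed

theorem corollary2p42:
  fixes X :: "('x, 'y) cat" and A :: "('o, 'm) cat"
    and G :: "('x, 'y, 'o, 'm) func"
    and J :: "nat \<Rightarrow> (('o, 'm) tower_obj, 'm, 'x, 'y) adj_data"
    and n :: nat
    and B :: "nat \<Rightarrow> ('o, 'm) cat"
    and U :: "nat \<Rightarrow> ('o, 'm, 'o, 'm) func"
    and R :: "('x, 'y, 'o, 'm) func"
  assumes "category X" and "category A"
    and "right_adjoint X A G"
    and "tower_adjunctions X A G J"
    and "\<forall>k>0. has_reflexive_coequalizers (tower_cat A G J k)"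
    and "B 0 = A"
    and "\<forall>i\<in>{1..n}. strictly_monadic (B i) (B (i - 1)) (U i)"
    and "coreflection X (B n) R"
    and "func_eq_on X G (comp_chain U n \<circ>\<^sub>F R)"
  shows "\<exists>k\<le>n. tower_stabilizes_at A G J k"
proof -
  note tower = assms(4)
  interpret X: category X by fact
  obtain JR where "adjunction X (B n) R JR" "fully_faithful (B n) X (LAdj JR)"
    using assms(8) by (auto simp: coreflection_def)
  then have refl: "coreflective X (B n) R JR"
    by (simp add: coreflective_def coreflective_axioms_def)
  interpret R: coreflective X "B n" R JR by (rule refl)
  have U: "cat_functor (B i) (B (i - 1)) (U i)" "faithful (B i) (U i)"
      "creates_split_coequalizers (B i) (B (i - 1)) (U i)" if "i \<in> {1..n}" for i
    using strictly_monadic_beck that assms(7) by blast+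
  have cat_B: "category (B i)" if "i \<le> n" for i
  proof (cases i)
    case 0
    then show ?thesis using assms(2,6) by simp
  next
    case (Suc j)
    then show ?thesis using U(1)[of i] that by (simp add: cat_functor_def)
  qed
  \<comment> \<open>\<open>H k = U (k + 1) \<circ> \<dots> \<circ> U n \<circ> R\<close>, the part of the decomposition above \<open>B k\<close>\<close>
  define H where "H = (\<lambda>k. comp_chain (\<lambda>i. U (k + i)) (n - k) \<circ>\<^sub>F R)"
  have H: "cat_functor X (B k) (H k)" if "k \<le> n" for k
  proof -
    have "cat_functor (B (k + (n - k))) (B (k + 0)) (comp_chain (\<lambda>i. U (k + i)) (n - k))"
      by (rule comp_chain_functor) (use cat_B U(1) that in \<open>auto simp: Suc_le_eq\<close>)
    then show ?thesis
      using that cat_functor_comp[OF R.right.cat_functor_axioms] by (simp add: H_def)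
  qed
  have H_Suc: "H k \<star> f = U (Suc k) \<star> H (Suc k) \<star> f" if "k < n" for k f
  proof -
    have "n - k = Suc (n - Suc k)" using that by simp
    then show ?thesis by (simp add: H_def comp_chain_Suc_left amap_comp_func del: comp_chain.simps)
  qed
  have H_0: "G \<star> f = H 0 \<star> f" if "arr X f" for f
    using assms(9) that by (simp add: X.func_eq_on_iff H_def)
  have W: "cat_functor (B n) A (comp_chain U n)"
    using comp_chain_functor[of B n U] assms(2,6) U(1) by simp
  have counit: "\<exists>s. R.counit_inverse (FObj (LAdj (J k)) a) s" if "a \<in> Obj (tower_cat A G J k)" for k a
    by (rule tower_counit_inverse[OF assms(2) tower refl W _ that])
      (simp add: H_0 H_def amap_comp_func)
  have A\<^sub>0: "category (level_zero A)"
    using comparison_step.axioms(1)[OF tower_step[OF tower, of 0]]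
    by (simp add: adjunction_def cat_functor_def)
  note copy = base_copy[OF assms(2) A\<^sub>0]
  have lift: "\<exists>N. cat_functor (tower_cat A G J k) (B k) N \<and> faithful (tower_cat A G J k) N \<and>
      conservative (tower_cat A G J k) (B k) N \<and> (\<forall>f. arr X f \<longrightarrow> N \<star> tower_func A G J k \<star> f = H k \<star> f)"
    if "k \<le> n" for k
    using that
  proof (induction k)
    case 0
    show ?case
      using copy(2-4) copy(5) H_0 assms(6)
      by (intro exI[of _ from_level_zero]) (simp add: amap_comp_func)
  next
    case (Suc k)
    then obtain N where N: "cat_functor (tower_cat A G J k) (B k) N" "faithful (tower_cat A G J k) N"
      "conservative (tower_cat A G J k) (B k) N" "\<And>f. arr X f \<Longrightarrow> N \<star> tower_func A G J k \<star> f = H k \<star> f"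
      by auto
    interpret S: comparison_step X "tower_cat A G J k" "tower_func A G J k" "J k" "J (Suc k)"
      by (rule tower_step[OF tower])
    have k: "Suc k \<in> {1..n}" using Suc.prems by simp
    have NG: "N \<star> tower_func A G J k \<star> f = U (Suc k) \<star> H (Suc k) \<star> f" if "arr X f" for f
      using N(4)[OF that] H_Suc[of k f] Suc.prems by simp
    show ?case
      unfolding tower_Suc
      by (rule S.lift_to_step[OF N(1-3) U(1)[OF k, simplified] U(2)[OF k] U(3)[OF k, simplified]
          H[OF Suc.prems] NG]) auto
  qed
  have "invertible (tower_cat A G J n) (unit_arr (tower_func A G J n) (J n) a)"
    if a: "a \<in> Obj (tower_cat A G J n)" for a
  proof (cases n)
    case 0
    interpret S: comparison_step X "tower_cat A G J 0" "tower_func A G J 0" "J 0" "J (Suc 0)"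
      by (rule tower_step[OF tower])
    let ?N = "rename_func unBase :: (('o, 'm) tower_obj, 'm, 'o, 'm) func"
    let ?E = "rename_func Base :: ('o, 'm, ('o, 'm) tower_obj, 'm) func"
    interpret N: cat_functor "tower_cat A G J 0" "B n" ?N using copy(2) 0 assms(6) by simp
    interpret E: cat_functor "B n" "tower_cat A G J 0" ?E using copy(1) 0 assms(6) by simp
    have NG: "?N \<star> tower_func A G J 0 \<star> f = R \<star> f" if "arr X f" for f
      using copy(5) H_0[OF that] 0 by (simp add: H_def amap_comp_func)
    have a0: "a \<in> Obj (tower_cat A G J 0)" using a 0 by simp
    have "invertible (tower_cat A G J 0) (S.base.\<eta> a)"
      by (rule unit_iso_if_codomain_isomorphic[OF refl S.base.adjunction_axioms
            N.cat_functor_axioms E.cat_functor_axioms _ _ NG a0])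
        (use copy(5,6) counit[OF a0] in simp_all)
    then show ?thesis unfolding 0 .
  next
    case (Suc m)
    then have m: "Suc m \<in> {1..n}" "m \<le> n" by simp_all
    obtain N where N: "cat_functor (tower_cat A G J m) (B m) N" "faithful (tower_cat A G J m) N"
      "conservative (tower_cat A G J m) (B m) N" "\<And>f. arr X f \<Longrightarrow> N \<star> tower_func A G J m \<star> f = H m \<star> f"
      using lift[OF m(2)] by auto
    interpret S: comparison_step X "tower_cat A G J m" "tower_func A G J m" "J m" "J (Suc m)"
      by (rule tower_step[OF tower])
    have HR: "H (Suc m) \<star> f = R \<star> f" for f
      using Suc by (simp add: H_def amap_comp_func)
    have NG: "N \<star> tower_func A G J m \<star> f = U (Suc m) \<star> R \<star> f" if "arr X f" for f
      using N(4)[OF that] H_Suc[of m f] HR Suc by simp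
    have U': "cat_functor (B n) (B m) (U n)" "faithful (B n) (U n)"
        "creates_split_coequalizers (B n) (B m) (U n)"
      using U[OF m(1)] Suc by simp_all
    obtain N' where N': "cat_functor S.A' (B n) N'" "faithful S.A' N'" "conservative S.A' (B n) N'"
      "\<And>f. arr X f \<Longrightarrow> N' \<star> S.G' \<star> f = R \<star> f" "\<And>f. arr S.A' f \<Longrightarrow> U n \<star> N' \<star> f = N \<star> S.V \<star> f"
      by (rule S.lift_to_step[OF N(1-3) U' R.right.cat_functor_axioms]) (use NG Suc in auto)
    have "invertible S.A' (S.step.\<eta> c)" if "c \<in> Obj S.A'" for c
      by (rule S.unit_iso_at_lift[OF refl counit N(1) U'(1,2) N'(1-3) _ _ that]) (use N'(4,5) in auto)
    then show ?thesis using a unfolding Suc tower_Suc by simp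
  qed
  then have "tower_stabilizes_at A G J n"
    by (rule tower_stabilizes_if_unit_iso[OF tower])
  then show ?thesis by blast
qed

end
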